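(* Let $X$ be a compact Hausdorff space with a regular Borel probability measure $\mu$ and let $\varphi\colon X\to X$ be a Borel map. Assume that $\mu$ is $\varphi$-bounded and that $C_\varphi$ is a (bounded and) bounded below operator of $\mathcal{B}(L^2(X,\mu))$. Let $\xi_1,\dots,\xi_n\in L^\infty(X,\mu)$. Then the following are equivalent: (1) $\{\xi_i\}_{i=1}^n$ is an orthonormal basis for the Hilbert module $L^\infty(X,\mu)_{\mathcal{L}}$; (2) $\{\xi_iS_\varphi\}_{i=1}^n$ is an orthonormal basis for the Hilbert module $\mathcal{E}(X,\mu)$; (3) $\{\xi_iS_\varphi\}_{i=1}^n$ is a Cuntz family that implements $\alpha$.
   Context: $\mu$ is $\varphi$-bounded if there is $K>0$ with $\mu(\varphi(E))\le K\mu(E)$ for all measurable $E\subseteq X$ (the sets $\varphi(E)$ being understood to be measurable). $C_\varphi$ is the composition operator $f\mapsto f\circ\varphi$; the assumption on $C_\varphi$ is that it extends from $C(X)$ to an operator on $L^2(X,\mu)$ and there are constants $c_0,c_1>0$ with $c_0\|\xi\|_2\le\|C_\varphi\xi\|_2\le c_1\|\xi\|_2$ for all $\xi\in L^2(X,\mu)$. Under these assumptions $\varphi$ and $\varphi^{-1}$ preserve the $\mu$-null sets and $\alpha\colon L^\infty(X,\mu)\to L^\infty(X,\mu)$, $\alpha(f)=f\circ\varphi$, is a well-defined $*$-homomorphism. $L^\infty(X,\mu)$ is identified with the multiplication operators on $L^2(X,\mu)$. Let $C_\varphi=S_\varphi a_\varphi$ be the polar decomposition; $S_\varphi$ is an isometry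 and $a_\varphi=(C_\varphi^*C_\varphi)^{1/2}$ is an invertible element of $L^\infty(X,\mu)$. Define $\mathcal{E}(X,\mu)=\{T\in\mathcal{B}(L^2(X,\mu)):Ta=\alpha(a)T\text{ for all }a\in L^\infty(X,\mu)\}$, a Hilbert module over $L^\infty(X,\mu)$ with $S\cdot a=Sa$ and $\langle S,T\rangle=S^*T$; one has $S_\varphi\in\mathcal{E}(X,\mu)$. Define the transfer operator $\mathcal{L}\colon L^\infty(X,\mu)\to L^\infty(X,\mu)$ by $\mathcal{L}(a)=S_\varphi^*aS_\varphi$. $L^\infty(X,\mu)_{\mathcal{L}}$ is $L^\infty(X,\mu)$ as a vector space, with right action $\xi\cdot a=\xi\alpha(a)$ and inner product $\langle\eta,\xi\rangle_{\mathcal{L}}=\mathcal{L}(\eta^*\xi)$; under the stated assumptions it is a Hilbert module over $L^\infty(X,\mu)$. An orthonormal basis of a Hilbert module $\mathcal{M}$ over a unital C*-algebra $A$ is a subset $\{\xi_1,\dots,\xi_n\}$ of $\mathcal{M}$ with $\langle\xi_i,\xi_j\rangle=\delta_{ij}1_A$ and $\xi=\sum_{i=1}^n\xi_i\cdot\langle\xi_i,\xi\rangle$ for all $\xi\in\mathcal{M}$. A Cuntz family $\{S_i\}_{i=1}^n\subset\mathcal{B}(L^2(X,\mu))$ satisfies $S_i^*S_j=\delta_{ij}I$ and $\sum_{i=1}^nS_iS_i^*=I$; it implements $\alpha$ if $\alpha(a)=\sum_{i=1}^nS_iaS_i^*$ for all $a\in L^\infty(X,\mu)$. *)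

theory Defs
  imports "HOL-Probability.Probability" "HOL-Library.Function_Algebras"
begin

text \<open>
  Elements of L2 and of L-infinity are represented by functions and operators on L2 by maps on
  such functions; equality in these spaces is equality almost everywhere
  (\<open>ae_eq\<close>, \<open>op_eq\<close>). By \<open>Function_Algebras\<close>, \<open>0\<close>, \<open>1\<close>, \<open>+\<close>, \<open>*\<close> on functions are
  pointwise; on operators only \<open>+\<close> and \<open>0\<close> are used, composition is \<open>\<circ>\<close> and the identity is \<open>id\<close>.
\<close>

definition regular_borel_measure :: "'a::t2_space measure \<Rightarrow> bool" where
  "regular_borel_measure M \<longleftrightarrow> sets M = sets borel \<and>
     (\<forall>E\<in>sets M.
        emeasure M E = (INF U\<in>{U. open U \<and> E \<subseteq> U}. emeasure M U) \<and>
        emeasure M E = (SUP K\<in>{K. compact K \<and> K \<subseteq> E}. emeasure M K))"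

text \<open>
  Measurable sets are those of the completion. If the image of every Borel set is Borel and the
  inequality holds on Borel sets, then this condition holds with the same constant.
\<close>

definition map_bounded :: "'a measure \<Rightarrow> ('a \<Rightarrow> 'a) \<Rightarrow> bool" where
  "map_bounded M \<phi> \<longleftrightarrow> (\<exists>K>0. \<forall>E\<in>sets (completion M).
     \<phi> ` E \<in> sets (completion M) \<and>
     measure (completion M) (\<phi> ` E) \<le> K * measure (completion M) E)"


subsection \<open>The spaces L2 and L-infinity, and bounded operators on L2\<close>

definition ae_eq :: "'a measure \<Rightarrow> ('a \<Rightarrow> complex) \<Rightarrow> ('a \<Rightarrow> complex) \<Rightarrow> bool" where
  "ae_eq M f g \<longleftrightarrow> (AE x in M. f x = g x)"

definition L2 :: "'a measure \<Rightarrow> ('a \<Rightarrow> complex) set" where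
  "L2 M = {f \<in> borel_measurable M. integrable M (\<lambda>x. (norm (f x))\<^sup>2)}"

definition Linf :: "'a measure \<Rightarrow> ('a \<Rightarrow> complex) set" where
  "Linf M = {f \<in> borel_measurable M. \<exists>K. AE x in M. norm (f x) \<le> K}"

definition L2_inner :: "'a measure \<Rightarrow> ('a \<Rightarrow> complex) \<Rightarrow> ('a \<Rightarrow> complex) \<Rightarrow> complex" where
  "L2_inner M f g = (LINT x|M. f x * cnj (g x))"

definition L2_norm :: "'a measure \<Rightarrow> ('a \<Rightarrow> complex) \<Rightarrow> real" where
  "L2_norm M f = sqrt (LINT x|M. (norm (f x))\<^sup>2)"

type_synonym 'a op = "('a \<Rightarrow> complex) \<Rightarrow> ('a \<Rightarrow> complex)"

definition op_eq :: "'a measure \<Rightarrow> 'a op \<Rightarrow> 'a op \<Rightarrow> bool" where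
  "op_eq M S T \<longleftrightarrow> (\<forall>f\<in>L2 M. ae_eq M (S f) (T f))"

definition BL2 :: "'a measure \<Rightarrow> 'a op set" where
  "BL2 M = {T.
     (\<forall>f\<in>L2 M. T f \<in> L2 M) \<and>
     (\<forall>f\<in>L2 M. \<forall>g\<in>L2 M. ae_eq M f g \<longrightarrow> ae_eq M (T f) (T g)) \<and>
     (\<forall>f\<in>L2 M. \<forall>g\<in>L2 M. ae_eq M (T (f + g)) (T f + T g)) \<and>
     (\<forall>c. \<forall>f\<in>L2 M. ae_eq M (T (\<lambda>x. c * f x)) (\<lambda>x. c * T f x)) \<and>
     (\<exists>K. \<forall>f\<in>L2 M. L2_norm M (T f) \<le> K * L2_norm M f)}"

definition bounded_below :: "'a measure \<Rightarrow> 'a op \<Rightarrow> bool" where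
  "bounded_below M T \<longleftrightarrow> (\<exists>c>0. \<forall>f\<in>L2 M. c * L2_norm M f \<le> L2_norm M (T f))"

definition is_adjoint :: "'a measure \<Rightarrow> 'a op \<Rightarrow> 'a op \<Rightarrow> bool" where
  "is_adjoint M T T' \<longleftrightarrow> T' \<in> BL2 M \<and>
     (\<forall>f\<in>L2 M. \<forall>g\<in>L2 M. L2_inner M (T f) g = L2_inner M f (T' g))"

text \<open>For \<open>T \<in> BL2 M\<close> the adjoint exists and is unique up to \<open>op_eq M\<close>.\<close>

definition adj :: "'a measure \<Rightarrow> 'a op \<Rightarrow> 'a op" where
  "adj M T = (SOME T'. is_adjoint M T T')"

definition positive_op :: "'a measure \<Rightarrow> 'a op \<Rightarrow> bool" where
  "positive_op M A \<longleftrightarrow> A \<in> BL2 M \<and>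
     (\<forall>f\<in>L2 M. L2_inner M (A f) f \<in> \<real> \<and> 0 \<le> Re (L2_inner M (A f) f))"

definition op_kernel :: "'a measure \<Rightarrow> 'a op \<Rightarrow> ('a \<Rightarrow> complex) set" where
  "op_kernel M T = {f \<in> L2 M. ae_eq M (T f) 0}"

definition partial_isometry :: "'a measure \<Rightarrow> 'a op \<Rightarrow> bool" where
  "partial_isometry M S \<longleftrightarrow> S \<in> BL2 M \<and>
     (\<forall>f\<in>L2 M. (\<forall>g\<in>op_kernel M S. L2_inner M f g = 0) \<longrightarrow> L2_norm M (S f) = L2_norm M f)"

text \<open>\<open>T = S A\<close> with \<open>A\<close> the positive square root of \<open>T\<^sup>* T\<close>; the kernel condition makes \<open>S\<close> unique.\<close>

definition polar_decomposition :: "'a measure \<Rightarrow> 'a op \<Rightarrow> 'a op \<Rightarrow> 'a op \<Rightarrow> bool" where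
  "polar_decomposition M T S A \<longleftrightarrow>
     positive_op M A \<and> op_eq M (A \<circ> A) (adj M T \<circ> T) \<and>
     partial_isometry M S \<and> op_kernel M S = op_kernel M T \<and>
     op_eq M T (S \<circ> A)"

definition mult_op :: "('a \<Rightarrow> complex) \<Rightarrow> 'a op" where
  "mult_op a f = a * f"

text \<open>
  The element of L-infinity identified with an operator that is a multiplication operator
  (unique up to \<open>ae_eq M\<close>).
\<close>

definition op_symbol :: "'a measure \<Rightarrow> 'a op \<Rightarrow> ('a \<Rightarrow> complex)" where
  "op_symbol M T = (SOME b. b \<in> Linf M \<and> op_eq M T (mult_op b))"

definition comp_op :: "('a \<Rightarrow> 'a) \<Rightarrow> 'a op" where
  "comp_op \<phi> f = f \<circ> \<phi>"

definition alpha :: "('a \<Rightarrow> 'a) \<Rightarrow> ('a \<Rightarrow> complex) \<Rightarrow> ('a \<Rightarrow> complex)" where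
  "alpha \<phi> a = a \<circ> \<phi>"


subsection \<open>Hilbert modules and orthonormal bases\<close>

text \<open>
  The data of a right Hilbert module: \<open>'m\<close> holds representatives of module elements, \<open>'c\<close>
  representatives of elements of the coefficient algebra.
\<close>

record ('m, 'c) hilbert_module =
  elems :: "'m set"
  elem_eq :: "'m \<Rightarrow> 'm \<Rightarrow> bool"
  coeff_eq :: "'c \<Rightarrow> 'c \<Rightarrow> bool"
  act :: "'m \<Rightarrow> 'c \<Rightarrow> 'm"
  mod_inner :: "'m \<Rightarrow> 'm \<Rightarrow> 'c"

definition orthonormal_basis ::
  "('m::comm_monoid_add, 'c::{zero,one}) hilbert_module \<Rightarrow> nat \<Rightarrow> (nat \<Rightarrow> 'm) \<Rightarrow> bool" where
  "orthonormal_basis H n \<xi> \<longleftrightarrow>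
     (\<forall>i\<in>{1..n}. \<xi> i \<in> elems H) \<and>
     (\<forall>i\<in>{1..n}. \<forall>j\<in>{1..n}.
        coeff_eq H (mod_inner H (\<xi> i) (\<xi> j)) (if i = j then 1 else 0)) \<and>
     (\<forall>\<eta>\<in>elems H. elem_eq H \<eta> (\<Sum>i\<in>{1..n}. act H (\<xi> i) (mod_inner H (\<xi> i) \<eta>)))"

definition intertwiner_module ::
  "'a measure \<Rightarrow> ('a \<Rightarrow> 'a) \<Rightarrow> ('a op, 'a \<Rightarrow> complex) hilbert_module" where
  "intertwiner_module M \<phi> =
     \<lparr> elems = {T \<in> BL2 M. \<forall>a\<in>Linf M. op_eq M (T \<circ> mult_op a) (mult_op (alpha \<phi> a) \<circ> T)},
       elem_eq = op_eq M,
       coeff_eq = ae_eq M,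
       act = (\<lambda>T a. T \<circ> mult_op a),
       mod_inner = (\<lambda>S T. op_symbol M (adj M S \<circ> T)) \<rparr>"

definition transfer_operator ::
  "'a measure \<Rightarrow> 'a op \<Rightarrow> ('a \<Rightarrow> complex) \<Rightarrow> ('a \<Rightarrow> complex)" where
  "transfer_operator M S a = op_symbol M (adj M S \<circ> mult_op a \<circ> S)"

definition transfer_module ::
  "'a measure \<Rightarrow> ('a \<Rightarrow> 'a) \<Rightarrow> 'a op \<Rightarrow> ('a \<Rightarrow> complex, 'a \<Rightarrow> complex) hilbert_module" where
  "transfer_module M \<phi> S =
     \<lparr> elems = Linf M,
       elem_eq = ae_eq M,
       coeff_eq = ae_eq M,
       act = (\<lambda>\<xi> a. \<xi> * alpha \<phi> a),
       mod_inner = (\<lambda>\<eta> \<xi>. transfer_operator M S ((\<lambda>x. cnj (\<eta> x)) * \<xi>)) \<rparr>"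


subsection \<open>Cuntz families\<close>

definition cuntz_family :: "'a measure \<Rightarrow> nat \<Rightarrow> (nat \<Rightarrow> 'a op) \<Rightarrow> bool" where
  "cuntz_family M n T \<longleftrightarrow>
     (\<forall>i\<in>{1..n}. T i \<in> BL2 M) \<and>
     (\<forall>i\<in>{1..n}. \<forall>j\<in>{1..n}. op_eq M (adj M (T i) \<circ> T j) (if i = j then id else 0)) \<and>
     op_eq M (\<Sum>i\<in>{1..n}. T i \<circ> adj M (T i)) id"

definition implements_alpha ::
  "'a measure \<Rightarrow> ('a \<Rightarrow> 'a) \<Rightarrow> nat \<Rightarrow> (nat \<Rightarrow> 'a op) \<Rightarrow> bool" where
  "implements_alpha M \<phi> n T \<longleftrightarrow>
     (\<forall>a\<in>Linf M. op_eq M (mult_op (alpha \<phi> a)) (\<Sum>i\<in>{1..n}. T i \<circ> mult_op a \<circ> adj M (T i)))"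

end

theory Submission
  imports Defs
begin

text \<open>
  Write \<open>C\<close> for the composition operator, \<open>S\<close> for the isometric factor of its polar decomposition,
  and \<open>T\<^sub>i = \<xi>\<^sub>i S\<close>. Each of the three conditions splits into the same two statements: the operators
  \<open>T\<^sub>i\<^sup>* T\<^sub>j\<close> are \<open>\<delta>\<^sub>i\<^sub>j\<close>, and the frame operator \<open>P = \<Sum>\<^sub>i T\<^sub>i T\<^sub>i\<^sup>*\<close> is the identity.

  The first half is the same in all three because both module inner products are symbols of
  the operator \<open>T\<^sub>i\<^sup>* T\<^sub>j = S\<^sup>* \<xi>\<^sub>i\<^sup>* \<xi>\<^sub>j S\<close>. That such operators are multiplications at all is maximal
  commutativity: if \<open>U\<close> and \<open>V\<close> intertwine every \<open>a\<close> with \<open>\<alpha>(a)\<close>, then \<open>U\<^sup>* V\<close> commutes with L-infinity,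
  and an operator commuting with L-infinity is a multiplication operator
  (\<open>mult_op_if_commutes\<close>, \<open>adjoint_comp_is_mult_op\<close>).

  For the second half, the basis expansion of an intertwiner \<open>V\<close> is \<open>\<Sum>\<^sub>i T\<^sub>i T\<^sub>i\<^sup>* V = P V\<close>, and the expansion
  of \<open>\<eta>\<close> in the transfer module, multiplied by \<open>S\<close>, is \<open>P \<eta> S\<close>. So both expansion properties say that \<open>P\<close>
  fixes certain operators, among them all \<open>\<eta> S\<close>. Since \<open>S\<close> attains the constant function \<open>1\<close>, \<open>P\<close> then
  fixes every \<open>\<eta>\<close> in L-infinity, which is dense in L2, and \<open>P\<close> is the identity
  (\<open>frame_operator_eq_id_if_fixes_Linf\<close>). Conversely \<open>P = 1\<close> gives the expansions, and it also gives
  \<open>\<alpha>(a) = \<alpha>(a) P = \<Sum>\<^sub>i T\<^sub>i a T\<^sub>i\<^sup>*\<close>, so that a Cuntz family of this form implements \<open>\<alpha>\<close> automatically.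

  It remains to see that \<open>S\<close> has an adjoint, intertwines, and attains \<open>1\<close>. The adjoint of \<open>C\<close> is given by
  Radon-Nikodym derivatives (\<open>adjoint_exists\<close>). The operator \<open>C\<^sup>* C\<close> is multiplication by some \<open>b\<close>, bounded
  away from \<open>0\<close> because \<open>C\<close> is bounded below. Uniqueness of positive square roots
  (\<open>positive_sqrt_unique\<close>) identifies the positive factor as multiplication by \<open>s = \<surd>b\<close>, hence
  \<open>S = C s\<^sup>-\<^sup>1\<close>, from which the three properties are read off; in particular \<open>S s = C 1 = 1\<close>.
\<close>

section \<open>The inner product of square-integrable functions\<close>

lemma borel_measurable_cnj [measurable]:
  "f \<in> borel_measurable M \<Longrightarrow> (\<lambda>x. cnj (f x)) \<in> borel_measurable M"
  by (rule borel_measurable_continuous_on[of cnj]) (auto intro: continuous_intros)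

lemma sum_fun_apply: "(\<Sum>i\<in>I. f i) x = (\<Sum>i\<in>I. (f i x :: 'b::comm_monoid_add))"
  by (induction I rule: infinite_finite_induct) auto

lemma ae_eq_refl [simp]: "ae_eq M f f"
  by (simp add: ae_eq_def)

lemma ae_eq_sym: "ae_eq M f g \<Longrightarrow> ae_eq M g f"
  by (auto simp: ae_eq_def elim: eventually_mono)

lemma ae_eq_trans [trans]: "ae_eq M f g \<Longrightarrow> ae_eq M g h \<Longrightarrow> ae_eq M f h"
  unfolding ae_eq_def by (auto elim: eventually_elim2)

lemma ae_eq_add: "ae_eq M f f' \<Longrightarrow> ae_eq M g g' \<Longrightarrow> ae_eq M (f + g) (f' + g')"
  unfolding ae_eq_def by (auto elim: eventually_elim2)

lemma ae_eq_mult: "ae_eq M f f' \<Longrightarrow> ae_eq M g g' \<Longrightarrow> ae_eq M (f * g) (f' * g')"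
  unfolding ae_eq_def by (auto elim: eventually_elim2)

lemma ae_eq_sum: "(\<And>i. i \<in> I \<Longrightarrow> ae_eq M (f i) (g i)) \<Longrightarrow> ae_eq M (\<Sum>i\<in>I. f i) (\<Sum>i\<in>I. g i)"
  by (induction I rule: infinite_finite_induct) (simp_all add: ae_eq_add)

lemma L2D: "f \<in> L2 M \<Longrightarrow> f \<in> borel_measurable M"
  "f \<in> L2 M \<Longrightarrow> integrable M (\<lambda>x. (norm (f x))\<^sup>2)"
  by (simp_all add: L2_def)

lemma L2_prod_integrable:
  assumes "f \<in> L2 M" "g \<in> L2 M"
  shows "integrable M (\<lambda>x. f x * g x)"
proof (rule Bochner_Integration.integrable_bound)
  show "integrable M (\<lambda>x. (norm (f x))\<^sup>2 + (norm (g x))\<^sup>2)"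
    using assms by (auto simp: L2_def)
  show "(\<lambda>x. f x * g x) \<in> borel_measurable M"
    using assms by (auto simp: L2_def)
  have "norm (f x * g x) \<le> (norm (f x))\<^sup>2 + (norm (g x))\<^sup>2" for x
    using sum_squares_bound[of "norm (f x)" "norm (g x)"]
      mult_nonneg_nonneg[OF norm_ge_zero[of "f x"] norm_ge_zero[of "g x"]]
    unfolding norm_mult by linarith
  then show "AE x in M. norm (f x * g x) \<le> norm ((norm (f x))\<^sup>2 + (norm (g x))\<^sup>2)"
    by (auto intro!: AE_I2 order_trans[OF _ abs_ge_self])
qed

lemma L2_add:
  assumes "f \<in> L2 M" "g \<in> L2 M"
  shows "f + g \<in> L2 M"
proof -
  have "integrable M (\<lambda>x. (norm (f x + g x))\<^sup>2)"
  proof (rule Bochner_Integration.integrable_bound)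
    show "integrable M (\<lambda>x. 2 * (norm (f x))\<^sup>2 + 2 * (norm (g x))\<^sup>2)"
      using assms by (auto simp: L2_def)
    show "(\<lambda>x. (norm (f x + g x))\<^sup>2) \<in> borel_measurable M"
      using assms by (auto simp: L2_def)
    have "(norm (f x + g x))\<^sup>2 \<le> 2 * (norm (f x))\<^sup>2 + 2 * (norm (g x))\<^sup>2" for x
    proof -
      have "(norm (f x + g x))\<^sup>2 \<le> (norm (f x) + norm (g x))\<^sup>2"
        by (intro power_mono norm_triangle_ineq) auto
      also have "\<dots> \<le> 2 * (norm (f x))\<^sup>2 + 2 * (norm (g x))\<^sup>2"
        using sum_squares_bound[of "norm (f x)" "norm (g x)"] by (simp add: power2_sum)
      finally show ?thesis .
    qed
    then show "AE x in M. norm ((norm (f x + g x))\<^sup>2) \<le> norm (2 * (norm (f x))\<^sup>2 + 2 * (norm (g x))\<^sup>2)"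
      by (auto intro!: AE_I2 order_trans[OF _ abs_ge_self])
  qed
  then show ?thesis using assms by (auto simp: L2_def plus_fun_def)
qed

lemma L2_scale: "f \<in> L2 M \<Longrightarrow> (\<lambda>x. c * f x) \<in> L2 M"
  by (auto simp: L2_def norm_mult power_mult_distrib)

lemma L2_zero [simp]: "0 \<in> L2 M"
  by (auto simp: L2_def zero_fun_def)

lemma L2_cnj: "f \<in> L2 M \<Longrightarrow> (\<lambda>x. cnj (f x)) \<in> L2 M"
  by (auto simp: L2_def)

lemma Linf_cnj: "a \<in> Linf M \<Longrightarrow> (\<lambda>x. cnj (a x)) \<in> Linf M"
  by (auto simp: Linf_def)

lemma LinfE:
  assumes "a \<in> Linf M"
  obtains K where "0 \<le> K" "AE x in M. norm (a x) \<le> K"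
proof -
  obtain K where K: "AE x in M. norm (a x) \<le> K" using assms by (auto simp: Linf_def)
  have "AE x in M. norm (a x) \<le> \<bar>K\<bar>" using K by eventually_elim auto
  then show ?thesis using that[of "\<bar>K\<bar>"] by auto
qed

lemma Linf_mult:
  assumes "a \<in> Linf M" "b \<in> Linf M"
  shows "a * b \<in> Linf M"
proof -
  obtain K L where KL: "0 \<le> K" "AE x in M. norm (a x) \<le> K" "0 \<le> L" "AE x in M. norm (b x) \<le> L"
    using assms by (metis LinfE)
  have "AE x in M. norm ((a * b) x) \<le> K * L"
    using KL(2,4) by eventually_elim (use KL in \<open>auto simp: norm_mult intro!: mult_mono\<close>)
  then show ?thesis using assms by (auto simp: Linf_def times_fun_def)
qed

lemma Linf_const [simp]: "(\<lambda>x. c) \<in> Linf M"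
  by (auto simp: Linf_def)

lemma L2_norm_nonneg [simp]: "0 \<le> L2_norm M f"
  by (simp add: L2_norm_def)

lemma L2_norm_power2: "(L2_norm M f)\<^sup>2 = (LINT x|M. (norm (f x))\<^sup>2)"
  by (simp add: L2_norm_def)

lemma L2_norm_mono:
  assumes "f \<in> borel_measurable M" "g \<in> L2 M" "0 \<le> K" "AE x in M. norm (f x) \<le> K * norm (g x)"
  shows "f \<in> L2 M" "L2_norm M f \<le> K * L2_norm M g"
proof -
  have *: "AE x in M. (norm (f x))\<^sup>2 \<le> K\<^sup>2 * (norm (g x))\<^sup>2"
    using assms(4) by eventually_elim (metis norm_ge_zero power_mono power_mult_distrib)
  have i: "integrable M (\<lambda>x. K\<^sup>2 * (norm (g x))\<^sup>2)" using assms by (auto simp: L2_def)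
  show "f \<in> L2 M"
    unfolding L2_def using assms * 
    by (auto intro!: Bochner_Integration.integrable_bound[OF i] elim: eventually_mono)
  then have "(LINT x|M. (norm (f x))\<^sup>2) \<le> (LINT x|M. K\<^sup>2 * (norm (g x))\<^sup>2)"
    using i * by (intro integral_mono_AE L2D)
  then have "(L2_norm M f)\<^sup>2 \<le> (K * L2_norm M g)\<^sup>2"
    by (simp add: L2_norm_power2 power_mult_distrib)
  then show "L2_norm M f \<le> K * L2_norm M g"
    by (rule power2_le_imp_le) (simp add: assms(3))
qed

lemma Linf_mult_L2_bound:
  assumes "a \<in> Linf M"
  shows "\<exists>K. \<forall>f\<in>L2 M. a * f \<in> L2 M \<and> L2_norm M (a * f) \<le> K * L2_norm M f"
proof -
  obtain K where K: "0 \<le> K" "AE x in M. norm (a x) \<le> K" using assms by (rule LinfE)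
  have "a * f \<in> L2 M \<and> L2_norm M (a * f) \<le> K * L2_norm M f" if f: "f \<in> L2 M" for f
  proof -
    have m: "a * f \<in> borel_measurable M"
      using assms f by (auto simp: Linf_def L2_def times_fun_def)
    have "AE x in M. norm ((a * f) x) \<le> K * norm (f x)"
      using K(2) by eventually_elim (auto simp: norm_mult intro: mult_right_mono)
    from L2_norm_mono[OF m f K(1) this] show ?thesis by (simp add: times_fun_def)
  qed
  then show ?thesis by blast
qed

lemma Linf_mult_L2: "a \<in> Linf M \<Longrightarrow> f \<in> L2 M \<Longrightarrow> a * f \<in> L2 M"
  using Linf_mult_L2_bound by blast

lemma L2_norm_cong:
  assumes "f \<in> L2 M" "g \<in> L2 M" "ae_eq M f g"
  shows "L2_norm M f = L2_norm M g"
proof -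
  have "AE x in M. (norm (f x))\<^sup>2 = (norm (g x))\<^sup>2"
    using assms(3) unfolding ae_eq_def by eventually_elim simp
  then show ?thesis
    unfolding L2_norm_def using assms by (auto intro!: integral_cong_AE simp: L2_def)
qed

lemma L2_norm_eq_0_iff:
  assumes "f \<in> L2 M"
  shows "L2_norm M f = 0 \<longleftrightarrow> ae_eq M f 0"
  using integral_nonneg_eq_0_iff_AE[OF L2D(2)[OF assms]] by (simp add: L2_norm_def ae_eq_def)

lemma L2_inner_integrable:
  assumes "f \<in> L2 M" "g \<in> L2 M"
  shows "integrable M (\<lambda>x. f x * cnj (g x))"
  using L2_prod_integrable[OF assms(1) L2_cnj[OF assms(2)]] .

lemma L2_inner_cong:
  assumes "f \<in> L2 M" "g \<in> L2 M" "f' \<in> L2 M" "g' \<in> L2 M" "ae_eq M f f'" "ae_eq M g g'"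
  shows "L2_inner M f g = L2_inner M f' g'"
proof -
  have "AE x in M. f x * cnj (g x) = f' x * cnj (g' x)"
    using assms(5,6) unfolding ae_eq_def by eventually_elim simp
  then show ?thesis
    unfolding L2_inner_def using assms by (auto intro!: integral_cong_AE simp: L2_def)
qed

lemma L2_inner_add_left:
  "f \<in> L2 M \<Longrightarrow> g \<in> L2 M \<Longrightarrow> h \<in> L2 M \<Longrightarrow> L2_inner M (f + g) h = L2_inner M f h + L2_inner M g h"
  by (simp add: L2_inner_def algebra_simps L2_inner_integrable)

lemma L2_inner_commute: "L2_inner M g f = cnj (L2_inner M f g)"
proof -
  have "cnj (L2_inner M f g) = (LINT x|M. cnj (f x * cnj (g x)))"
    unfolding L2_inner_def by (rule Bochner_Integration.integral_cnj[symmetric])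
  then show ?thesis by (simp add: L2_inner_def mult.commute)
qed

lemma L2_inner_scale_left: "L2_inner M (\<lambda>x. c * f x) g = c * L2_inner M f g"
  by (simp add: L2_inner_def mult.assoc)

lemma L2_inner_add_right:
  "f \<in> L2 M \<Longrightarrow> g \<in> L2 M \<Longrightarrow> h \<in> L2 M \<Longrightarrow> L2_inner M f (g + h) = L2_inner M f g + L2_inner M f h"
  by (simp add: L2_inner_commute[of M f] L2_inner_add_left)

lemma L2_inner_scale_right: "L2_inner M f (\<lambda>x. c * g x) = cnj c * L2_inner M f g"
  by (simp add: L2_inner_commute[of M f] L2_inner_scale_left)

lemma L2_inner_mult_left: "L2_inner M (a * f) g = L2_inner M f ((\<lambda>x. cnj (a x)) * g)"
  by (simp add: L2_inner_def mult_ac)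

lemma L2_inner_self: "L2_inner M f f = of_real ((L2_norm M f)\<^sup>2)"
  unfolding L2_inner_def L2_norm_power2 
  by (simp add: complex_norm_square[symmetric] flip: integral_complex_of_real)

lemma L2_diff: "f \<in> L2 M \<Longrightarrow> g \<in> L2 M \<Longrightarrow> f + (\<lambda>x. -1 * g x) \<in> L2 M"
  by (intro L2_add L2_scale)

text \<open>
  Equalities between operators on classes of functions are mostly proved through inner products;
  the test function that separates \<open>f\<close> from \<open>g\<close> is their difference.
\<close>

lemma ae_eq_if_inner_eq:
  assumes "f \<in> L2 M" "g \<in> L2 M" "\<And>h. h \<in> L2 M \<Longrightarrow> L2_inner M f h = L2_inner M g h"
  shows "ae_eq M f g"
proof -
  let ?d = "f + (\<lambda>x. -1 * g x)"
  have d: "?d \<in> L2 M" using assms by (intro L2_diff)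
  have "L2_inner M ?d ?d = L2_inner M f ?d + -1 * L2_inner M g ?d"
    using L2_inner_add_left[OF assms(1) L2_scale[OF assms(2)] d, of "-1"]
    unfolding L2_inner_scale_left .
  then have "L2_inner M ?d ?d = 0" using assms(3)[OF d] by simp
  then have "ae_eq M ?d 0" using L2_norm_eq_0_iff[OF d] by (simp add: L2_inner_self)
  then show ?thesis by (auto simp: ae_eq_def elim: eventually_mono)
qed

lemma L2_Cauchy_Schwarz:
  assumes f: "f \<in> L2 M" and g: "g \<in> L2 M"
  shows "norm (L2_inner M f g) \<le> L2_norm M f * L2_norm M g"
proof -
  let ?F = "L2_norm M f" and ?G = "L2_norm M g"
  consider "?F = 0" | "?G = 0" | "0 < ?F" "0 < ?G"
    using L2_norm_nonneg by (metis less_eq_real_def)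
  then show ?thesis
  proof cases
    case 1
    then have "L2_inner M f g = L2_inner M 0 g"
      using f g by (intro L2_inner_cong) (auto simp: L2_norm_eq_0_iff)
    then show ?thesis using 1 by (simp add: L2_inner_def)
  next
    case 2
    then have "L2_inner M f g = L2_inner M f 0"
      using f g by (intro L2_inner_cong) (auto simp: L2_norm_eq_0_iff)
    then show ?thesis using 2 by (simp add: L2_inner_def)
  next
    case 3
    \<comment> \<open>The weight for which the arithmetic-geometric mean bound below becomes sharp after integration.\<close>
    let ?t = "?G / ?F"
    have t: "?t > 0" using 3 by simp
    have pt: "norm (f x * cnj (g x)) \<le> (?t * (norm (f x))\<^sup>2 + (norm (g x))\<^sup>2 / ?t) / 2" for x
    proof -
      have "0 \<le> (?t * norm (f x) - norm (g x))\<^sup>2 / ?t" using t by auto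
      also have "\<dots> = ?t * (norm (f x))\<^sup>2 + (norm (g x))\<^sup>2 / ?t - 2 * (norm (f x) * norm (g x))"
        using 3 by (simp add: power2_eq_square field_simps)
      finally show ?thesis by (simp add: norm_mult)
    qed
    have "norm (L2_inner M f g) \<le> (LINT x|M. norm (f x * cnj (g x)))"
      unfolding L2_inner_def by (rule integral_norm_bound)
    also have "\<dots> \<le> (LINT x|M. (?t * (norm (f x))\<^sup>2 + (norm (g x))\<^sup>2 / ?t) / 2)"
      using pt f g by (intro integral_mono integrable_norm L2_inner_integrable) (auto simp: L2D)
    also have "\<dots> = (?t * ?F\<^sup>2 + ?G\<^sup>2 / ?t) / 2"
      using f g by (simp add: L2_norm_power2 L2D)
    also have "\<dots> = ?F * ?G"
      using 3 by (simp add: power2_eq_square field_simps)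
    finally show ?thesis .
  qed
qed

lemma L2_norm_add_power2:
  assumes "f \<in> L2 M" "g \<in> L2 M"
  shows "(L2_norm M (f + g))\<^sup>2 = (L2_norm M f)\<^sup>2 + (L2_norm M g)\<^sup>2 + 2 * Re (L2_inner M f g)"
proof -
  have "complex_of_real ((L2_norm M (f + g))\<^sup>2) = L2_inner M (f + g) (f + g)"
    by (simp only: L2_inner_self)
  also have "\<dots> = L2_inner M f f + L2_inner M g g + (L2_inner M f g + cnj (L2_inner M f g))"
    using assms by (simp add: L2_inner_add_left L2_inner_add_right L2_add L2_inner_commute[of M g f])
  also have "\<dots> = complex_of_real ((L2_norm M f)\<^sup>2 + (L2_norm M g)\<^sup>2 + 2 * Re (L2_inner M f g))"
    by (simp add: L2_inner_self complex_add_cnj)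
  finally show ?thesis using of_real_eq_iff by blast
qed

lemma L2_norm_triangle:
  assumes "f \<in> L2 M" "g \<in> L2 M"
  shows "L2_norm M (f + g) \<le> L2_norm M f + L2_norm M g"
proof (rule power2_le_imp_le)
  have "Re (L2_inner M f g) \<le> L2_norm M f * L2_norm M g"
    using L2_Cauchy_Schwarz[OF assms] complex_Re_le_cmod order_trans by blast
  then show "(L2_norm M (f + g))\<^sup>2 \<le> (L2_norm M f + L2_norm M g)\<^sup>2"
    by (simp add: L2_norm_add_power2[OF assms] power2_sum)
qed simp

section \<open>Bounded operators\<close>

lemma BL2_L2: "T \<in> BL2 M \<Longrightarrow> f \<in> L2 M \<Longrightarrow> T f \<in> L2 M"
  by (simp add: BL2_def)

lemma BL2_cong: "T \<in> BL2 M \<Longrightarrow> f \<in> L2 M \<Longrightarrow> g \<in> L2 M \<Longrightarrow> ae_eq M f g \<Longrightarrow> ae_eq M (T f) (T g)"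
  by (simp add: BL2_def)

lemma BL2_add: "T \<in> BL2 M \<Longrightarrow> f \<in> L2 M \<Longrightarrow> g \<in> L2 M \<Longrightarrow> ae_eq M (T (f + g)) (T f + T g)"
  by (simp add: BL2_def)

lemma BL2_scale: "T \<in> BL2 M \<Longrightarrow> f \<in> L2 M \<Longrightarrow> ae_eq M (T (\<lambda>x. c * f x)) (\<lambda>x. c * T f x)"
  by (simp add: BL2_def)

lemma BL2_bound:
  assumes "T \<in> BL2 M"
  shows "\<exists>K\<ge>0. \<forall>f\<in>L2 M. L2_norm M (T f) \<le> K * L2_norm M f"
proof -
  obtain K where K: "\<forall>f\<in>L2 M. L2_norm M (T f) \<le> K * L2_norm M f"
    using assms unfolding BL2_def by blast
  have "L2_norm M (T f) \<le> \<bar>K\<bar> * L2_norm M f" if "f \<in> L2 M" for f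
    by (rule order_trans[OF bspec[OF K that]]) (simp add: mult_right_mono)
  then show ?thesis by (intro exI[of _ "\<bar>K\<bar>"]) simp
qed

lemma BL2_I:
  assumes "\<And>f. f \<in> L2 M \<Longrightarrow> T f \<in> L2 M"
    and "\<And>f g. f \<in> L2 M \<Longrightarrow> g \<in> L2 M \<Longrightarrow> ae_eq M f g \<Longrightarrow> ae_eq M (T f) (T g)"
    and "\<And>f g. f \<in> L2 M \<Longrightarrow> g \<in> L2 M \<Longrightarrow> ae_eq M (T (f + g)) (T f + T g)"
    and "\<And>c f. f \<in> L2 M \<Longrightarrow> ae_eq M (T (\<lambda>x. c * f x)) (\<lambda>x. c * T f x)"
    and "\<And>f. f \<in> L2 M \<Longrightarrow> L2_norm M (T f) \<le> K * L2_norm M f"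
  shows "T \<in> BL2 M"
  unfolding BL2_def
  by (intro CollectI conjI exI[of _ K] ballI allI impI) (blast intro: assms)+

lemma BL2_mult_op:
  assumes "a \<in> Linf M"
  shows "mult_op a \<in> BL2 M"
proof -
  obtain K where K: "\<And>f. f \<in> L2 M \<Longrightarrow> a * f \<in> L2 M"
    "\<And>f. f \<in> L2 M \<Longrightarrow> L2_norm M (a * f) \<le> K * L2_norm M f"
    using Linf_mult_L2_bound[OF assms] by blast
  have "a * (f + g) = a * f + a * g" "a * (\<lambda>x. c * f x) = (\<lambda>x. c * (a * f) x)" for f g c
    by (simp_all add: fun_eq_iff algebra_simps)
  then show ?thesis
    by (intro BL2_I[where K = K]) (simp_all add: mult_op_def ae_eq_mult K)
qed

lemma BL2_comp:
  assumes S: "S \<in> BL2 M" and T: "T \<in> BL2 M"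
  shows "S \<circ> T \<in> BL2 M"
proof -
  obtain K where K: "0 \<le> K" "\<And>f. f \<in> L2 M \<Longrightarrow> L2_norm M (S f) \<le> K * L2_norm M f"
    using BL2_bound[OF S] by blast
  obtain L where L: "0 \<le> L" "\<And>f. f \<in> L2 M \<Longrightarrow> L2_norm M (T f) \<le> L * L2_norm M f"
    using BL2_bound[OF T] by blast
  note mem = BL2_L2[OF S] BL2_L2[OF T]
  show ?thesis
  proof (rule BL2_I[where K = "K * L"])
    fix f assume f: "f \<in> L2 M"
    show "(S \<circ> T) f \<in> L2 M" using f mem by simp
    have "L2_norm M (S (T f)) \<le> K * L2_norm M (T f)" using f mem K by simp
    also have "\<dots> \<le> K * (L * L2_norm M f)" using f L K by (intro mult_left_mono) auto
    finally show "L2_norm M ((S \<circ> T) f) \<le> K * L * L2_norm M f" by simp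
    show "ae_eq M ((S \<circ> T) (\<lambda>x. c * f x)) (\<lambda>x. c * (S \<circ> T) f x)" for c
      using ae_eq_trans[OF BL2_cong[OF S _ _ BL2_scale[OF T f]] BL2_scale[OF S]] f
        BL2_L2[OF T L2_scale[OF f]] by (simp add: L2_scale mem)
    fix g assume g: "g \<in> L2 M"
    show "ae_eq M ((S \<circ> T) f) ((S \<circ> T) g)" if "ae_eq M f g"
      using f g mem that by (auto intro!: BL2_cong[OF S] BL2_cong[OF T])
    show "ae_eq M ((S \<circ> T) (f + g)) ((S \<circ> T) f + (S \<circ> T) g)"
      using ae_eq_trans[OF BL2_cong[OF S _ _ BL2_add[OF T f g]] BL2_add[OF S]] f g
      by (simp add: L2_add mem)
  qed
qed

lemma BL2_plus:
  assumes S: "S \<in> BL2 M" and T: "T \<in> BL2 M"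
  shows "S + T \<in> BL2 M"
proof -
  obtain K where K: "0 \<le> K" "\<And>f. f \<in> L2 M \<Longrightarrow> L2_norm M (S f) \<le> K * L2_norm M f"
    using BL2_bound[OF S] by blast
  obtain L where L: "0 \<le> L" "\<And>f. f \<in> L2 M \<Longrightarrow> L2_norm M (T f) \<le> L * L2_norm M f"
    using BL2_bound[OF T] by blast
  note mem = BL2_L2[OF S] BL2_L2[OF T]
  show ?thesis
  proof (rule BL2_I[where K = "K + L"])
    fix f assume f: "f \<in> L2 M"
    show "(S + T) f \<in> L2 M" using f mem by (simp add: L2_add)
    show "L2_norm M ((S + T) f) \<le> (K + L) * L2_norm M f"
      using L2_norm_triangle[OF mem(1)[OF f] mem(2)[OF f]] K(2)[OF f] L(2)[OF f]
      by (simp add: algebra_simps)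
    show "ae_eq M ((S + T) (\<lambda>x. c * f x)) (\<lambda>x. c * (S + T) f x)" for c
      using BL2_scale[OF S f, of c] BL2_scale[OF T f, of c] unfolding ae_eq_def
      by eventually_elim (simp add: algebra_simps)
    fix g assume g: "g \<in> L2 M"
    show "ae_eq M ((S + T) f) ((S + T) g)" if "ae_eq M f g"
      using BL2_cong[OF S f g that] BL2_cong[OF T f g that] by (simp add: ae_eq_add)
    show "ae_eq M ((S + T) (f + g)) ((S + T) f + (S + T) g)"
      using BL2_add[OF S f g] BL2_add[OF T f g] unfolding ae_eq_def
      by eventually_elim (simp add: algebra_simps)
  qed
qed

lemma BL2_zero: "0 \<in> BL2 M"
  by (intro BL2_I[where K = 0]) (auto simp: L2_norm_def ae_eq_def)

lemma BL2_id: "id \<in> BL2 M"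
  by (intro BL2_I[where K = 1]) auto

lemma BL2_sum: "(\<And>i. i \<in> I \<Longrightarrow> T i \<in> BL2 M) \<Longrightarrow> (\<Sum>i\<in>I. T i) \<in> BL2 M"
  by (induction I rule: infinite_finite_induct) (simp_all add: BL2_zero BL2_plus)

lemma op_eq_refl [simp]: "op_eq M S S"
  by (simp add: op_eq_def)

lemma op_eq_sym: "op_eq M S T \<Longrightarrow> op_eq M T S"
  by (simp add: op_eq_def ae_eq_sym)

lemma op_eq_trans [trans]: "op_eq M S T \<Longrightarrow> op_eq M T U \<Longrightarrow> op_eq M S U"
  unfolding op_eq_def by (meson ae_eq_trans)

lemma op_eq_comp_left: "op_eq M S T \<Longrightarrow> U \<in> BL2 M \<Longrightarrow> op_eq M (S \<circ> U) (T \<circ> U)"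
  by (simp add: op_eq_def BL2_L2)

lemma op_eq_comp_right:
  "op_eq M S T \<Longrightarrow> S \<in> BL2 M \<Longrightarrow> T \<in> BL2 M \<Longrightarrow> U \<in> BL2 M \<Longrightarrow> op_eq M (U \<circ> S) (U \<circ> T)"
  by (simp add: op_eq_def BL2_L2 BL2_cong)

lemma op_eq_sum:
  "(\<And>i. i \<in> I \<Longrightarrow> op_eq M (S i) (T i)) \<Longrightarrow> op_eq M (\<Sum>i\<in>I. S i) (\<Sum>i\<in>I. T i)"
  by (auto simp: op_eq_def sum_fun_apply[of _ I] intro: ae_eq_sum)

lemma op_eqD: "op_eq M S T \<Longrightarrow> f \<in> L2 M \<Longrightarrow> ae_eq M (S f) (T f)"
  by (simp add: op_eq_def)

lemma mult_op_mult: "mult_op (a * b) = mult_op a \<circ> mult_op b"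
  by (simp add: mult_op_def fun_eq_iff mult.assoc)

lemma mult_op_1: "mult_op 1 = id"
  by (simp add: mult_op_def fun_eq_iff)

lemma mult_op_0: "mult_op 0 = 0"
  by (simp add: mult_op_def fun_eq_iff)

lemma mult_op_sum: "(\<Sum>i\<in>I. mult_op (a i)) = mult_op (\<Sum>i\<in>I. a i)"
  by (simp add: fun_eq_iff mult_op_def sum_fun_apply sum_distrib_right)

lemma sum_comp: "(\<Sum>i\<in>I. T i) \<circ> U = (\<Sum>i\<in>I. T i \<circ> U)"
  by (simp add: fun_eq_iff sum_fun_apply)

lemma Linf_zero [simp]: "0 \<in> Linf M"
  by (simp add: zero_fun_def)

lemma Linf_add:
  assumes "a \<in> Linf M" "b \<in> Linf M"
  shows "a + b \<in> Linf M"
proof -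
  obtain K where K: "AE x in M. norm (a x) \<le> K" using assms(1) by (rule LinfE)
  obtain L where L: "AE x in M. norm (b x) \<le> L" using assms(2) by (rule LinfE)
  have "AE x in M. norm ((a + b) x) \<le> K + L"
    using K L by eventually_elim (auto intro: norm_triangle_le)
  then show ?thesis using assms by (auto simp: Linf_def plus_fun_def)
qed

lemma Linf_sum: "(\<And>i. i \<in> I \<Longrightarrow> a i \<in> Linf M) \<Longrightarrow> (\<Sum>i\<in>I. a i) \<in> Linf M"
  by (induction I rule: infinite_finite_induct) (simp_all add: Linf_add)

section \<open>Adjoints\<close>

lemma is_adjoint_BL2: "is_adjoint M T T' \<Longrightarrow> T' \<in> BL2 M"
  by (simp add: is_adjoint_def)

lemma is_adjoint_inner:
  "is_adjoint M T T' \<Longrightarrow> f \<in> L2 M \<Longrightarrow> g \<in> L2 M \<Longrightarrow> L2_inner M (T f) g = L2_inner M f (T' g)"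
  by (simp add: is_adjoint_def)

lemma is_adjoint_unique:
  assumes "is_adjoint M T T'" "is_adjoint M T T''"
  shows "op_eq M T' T''"
  unfolding op_eq_def
proof
  fix g assume g: "g \<in> L2 M"
  show "ae_eq M (T' g) (T'' g)"
  proof (rule ae_eq_if_inner_eq)
    fix h assume h: "h \<in> L2 M"
    have "L2_inner M h (T' g) = L2_inner M h (T'' g)"
      using is_adjoint_inner[OF assms(1) h g] is_adjoint_inner[OF assms(2) h g] by simp
    then show "L2_inner M (T' g) h = L2_inner M (T'' g) h"
      by (simp add: L2_inner_commute[of M "T' g" h] L2_inner_commute[of M "T'' g" h])
  qed (use g BL2_L2[OF is_adjoint_BL2[OF assms(1)]] BL2_L2[OF is_adjoint_BL2[OF assms(2)]] in auto)
qed

lemma is_adjoint_adj: "is_adjoint M T T' \<Longrightarrow> is_adjoint M T (adj M T)"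
  unfolding adj_def by (rule someI[of "is_adjoint M T"])

lemma is_adjoint_cong:
  assumes "op_eq M T U" "T \<in> BL2 M" "U \<in> BL2 M" "is_adjoint M T T'"
  shows "is_adjoint M U T'"
  unfolding is_adjoint_def
proof (intro conjI ballI)
  fix f g assume fg: "f \<in> L2 M" "g \<in> L2 M"
  have "L2_inner M (U f) g = L2_inner M (T f) g"
    using fg op_eqD[OF assms(1) fg(1)] BL2_L2[OF assms(2)] BL2_L2[OF assms(3)]
    by (intro L2_inner_cong) (auto intro: ae_eq_sym)
  then show "L2_inner M (U f) g = L2_inner M f (T' g)"
    using assms(4) fg by (simp add: is_adjoint_inner)
qed (use assms in \<open>simp add: is_adjoint_def\<close>)

lemma is_adjoint_comp:
  assumes "T \<in> BL2 M" "is_adjoint M S S'" "is_adjoint M T T'"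
  shows "is_adjoint M (S \<circ> T) (T' \<circ> S')"
  unfolding is_adjoint_def
  using BL2_comp[OF is_adjoint_BL2[OF assms(3)] is_adjoint_BL2[OF assms(2)]]
  by (simp add: is_adjoint_inner[OF assms(2)] is_adjoint_inner[OF assms(3)]
      BL2_L2[OF assms(1)] BL2_L2[OF is_adjoint_BL2[OF assms(2)]])

lemma is_adjoint_mult_op:
  assumes "a \<in> Linf M"
  shows "is_adjoint M (mult_op a) (mult_op (\<lambda>x. cnj (a x)))"
  unfolding is_adjoint_def using BL2_mult_op[OF Linf_cnj[OF assms]]
  by (simp add: mult_op_def L2_inner_mult_left)

text \<open>
  Linearity and boundedness of an adjoint come for free: the former because the inner product
  separates points, the latter by testing the defining identity on \<open>f = T' g\<close>.
\<close>

lemma is_adjointI: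
  assumes T: "T \<in> BL2 M" and L: "\<And>g. g \<in> L2 M \<Longrightarrow> T' g \<in> L2 M"
    and inner: "\<And>f g. f \<in> L2 M \<Longrightarrow> g \<in> L2 M \<Longrightarrow> L2_inner M (T f) g = L2_inner M f (T' g)"
  shows "is_adjoint M T T'"
proof -
  have inner': "L2_inner M (T' g) h = L2_inner M g (T h)" if "g \<in> L2 M" "h \<in> L2 M" for g h
    using inner[OF that(2,1)]
    by (simp add: L2_inner_commute[of M "T' g" h] L2_inner_commute[of M g "T h"])
  obtain K where K: "0 \<le> K" "\<And>f. f \<in> L2 M \<Longrightarrow> L2_norm M (T f) \<le> K * L2_norm M f"
    using BL2_bound[OF T] by blast
  have "T' \<in> BL2 M"
  proof (rule BL2_I[where K = K])
    fix f assume f: "f \<in> L2 M"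
    show "T' f \<in> L2 M" using L f .
    show "ae_eq M (T' (\<lambda>x. c * f x)) (\<lambda>x. c * T' f x)" for c
      using f by (intro ae_eq_if_inner_eq L L2_scale)
        (auto simp: inner' L2_scale L2_inner_scale_left)
    show "L2_norm M (T' f) \<le> K * L2_norm M f"
    proof (cases "L2_norm M (T' f) = 0")
      case False
      then have pos: "0 < L2_norm M (T' f)" using L2_norm_nonneg[of M "T' f"] by linarith
      have "(L2_norm M (T' f))\<^sup>2 = norm (L2_inner M (T' f) (T' f))"
        unfolding L2_inner_self by (simp del: of_real_power)
      also have "\<dots> = norm (L2_inner M (T (T' f)) f)" using f L by (simp add: inner)
      also have "\<dots> \<le> L2_norm M (T (T' f)) * L2_norm M f"
        using f L by (intro L2_Cauchy_Schwarz BL2_L2[OF T])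
      also have "\<dots> \<le> K * L2_norm M (T' f) * L2_norm M f"
        using f L K by (intro mult_right_mono) auto
      finally have "L2_norm M (T' f) * L2_norm M (T' f) \<le> L2_norm M (T' f) * (K * L2_norm M f)"
        by (simp add: power2_eq_square mult_ac)
      then show ?thesis using pos by simp
    qed (use K in simp)
    fix g assume g: "g \<in> L2 M"
    show "ae_eq M (T' (f + g)) (T' f + T' g)"
      using f g by (intro ae_eq_if_inner_eq L L2_add)
        (auto simp: inner' L2_add L2_inner_add_left L BL2_L2[OF T])
    assume fg: "ae_eq M f g"
    show "ae_eq M (T' f) (T' g)"
    proof (rule ae_eq_if_inner_eq)
      fix h assume h: "h \<in> L2 M"
      show "L2_inner M (T' f) h = L2_inner M (T' g) h"
        using f g h fg by (auto simp: inner' intro!: L2_inner_cong BL2_L2[OF T])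
    qed (use L f g in auto)
  qed
  then show ?thesis using inner by (simp add: is_adjoint_def)
qed

section \<open>Density of L-infinity and maximal commutativity\<close>

context finite_measure
begin

lemma one_L2 [simp]: "1 \<in> L2 M"
  by (simp add: L2_def one_fun_def)

lemma Linf_L2:
  assumes "a \<in> Linf M"
  shows "a \<in> L2 M"
proof -
  have "a * 1 = a" by (simp add: fun_eq_iff)
  then show ?thesis using Linf_mult_L2[OF assms one_L2] by simp
qed

lemma indicator_Linf: "E \<in> sets M \<Longrightarrow> (indicator E :: _ \<Rightarrow> complex) \<in> Linf M"
  by (auto simp: Linf_def indicator_def intro!: AE_I2 exI[of _ 1])

text \<open>
  The density of L-infinity in L2, on a finite measure space: cut \<open>f\<close> off where its modulus exceeds \<open>m\<close>;
  the remainders \<open>r m\<close> vanish in norm by dominated convergence.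
\<close>

lemma L2_truncation:
  assumes "f \<in> L2 M"
  obtains g r where "\<And>m. g m \<in> Linf M" "\<And>m. r m \<in> L2 M" "\<And>m. f = g m + r m"
    "(\<lambda>m. L2_norm M (r m)) \<longlonglongrightarrow> 0"
proof -
  have [measurable]: "f \<in> borel_measurable M" using assms by (rule L2D)
  define g where "g m = (\<lambda>x. if norm (f x) \<le> real m then f x else 0)" for m :: nat
  define r where "r m = (\<lambda>x. if norm (f x) \<le> real m then 0 else f x)" for m :: nat
  have "g m \<in> Linf M" for m
    unfolding Linf_def g_def by (auto intro!: exI[of _ "real m"])
  moreover have r: "r m \<in> L2 M" for m
    using assms by (rule L2_norm_mono(1)[where K = 1 and g = f, rotated]) (auto simp: r_def)
  moreover have "f = g m + r m" for m
    by (auto simp: g_def r_def fun_eq_iff)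
  moreover have "(\<lambda>m. L2_norm M (r m)) \<longlonglongrightarrow> 0"
  proof -
    have "(\<lambda>m. LINT x|M. (norm (r m x))\<^sup>2) \<longlonglongrightarrow> (LINT x|M. 0)"
    proof (rule integral_dominated_convergence[where w = "\<lambda>x. (norm (f x))\<^sup>2"])
      show "AE x in M. (\<lambda>m. (norm (r m x))\<^sup>2) \<longlonglongrightarrow> 0"
      proof (rule AE_I2)
        fix x
        obtain N where N: "norm (f x) \<le> real N" using real_arch_simple[of "norm (f x)"] by blast
        have "eventually (\<lambda>m. (norm (r m x))\<^sup>2 = 0) sequentially"
          using eventually_ge_at_top[of N]
        proof eventually_elim
          case (elim m)
          then have "norm (f x) \<le> real m" using N by linarith
          then show ?case by (simp add: r_def)
        qed
        then show "(\<lambda>m. (norm (r m x))\<^sup>2) \<longlonglongrightarrow> 0" by (rule tendsto_eventually)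
      qed
    qed (use assms in \<open>auto simp: r_def L2_def\<close>)
    then have "(\<lambda>m. sqrt (LINT x|M. (norm (r m x))\<^sup>2)) \<longlonglongrightarrow> sqrt 0"
      by (intro tendsto_real_sqrt) simp
    then show ?thesis by (simp add: L2_norm_def)
  qed
  ultimately show ?thesis using that by blast
qed

lemma op_eq_if_eq_on_Linf:
  assumes S: "S \<in> BL2 M" and T: "T \<in> BL2 M"
    and eq: "\<And>a. a \<in> Linf M \<Longrightarrow> ae_eq M (S a) (T a)"
  shows "op_eq M S T"
  unfolding op_eq_def
proof
  fix f assume f: "f \<in> L2 M"
  obtain K where K: "0 \<le> K" "\<And>f. f \<in> L2 M \<Longrightarrow> L2_norm M (S f) \<le> K * L2_norm M f"
    using BL2_bound[OF S] by blast
  obtain L where L: "0 \<le> L" "\<And>f. f \<in> L2 M \<Longrightarrow> L2_norm M (T f) \<le> L * L2_norm M f"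
    using BL2_bound[OF T] by blast
  note mem = BL2_L2[OF S] BL2_L2[OF T]
  obtain g r where gr: "\<And>m. g m \<in> Linf M" "\<And>m. r m \<in> L2 M" "\<And>m. f = g m + r m"
    "(\<lambda>m. L2_norm M (r m)) \<longlonglongrightarrow> 0"
    by (rule L2_truncation[OF f]) blast
  show "ae_eq M (S f) (T f)"
  proof (rule ae_eq_if_inner_eq)
    fix h assume h: "h \<in> L2 M"
    let ?d = "L2_inner M (S f) h - L2_inner M (T f) h"
    have le: "norm ?d \<le> (K + L) * L2_norm M h * L2_norm M (r m)" for m
    proof -
      note g = Linf_L2[OF gr(1)[of m]] and r = gr(2)[of m]
      have "L2_inner M (U f) h = L2_inner M (U (g m)) h + L2_inner M (U (r m)) h"
        if U: "U \<in> BL2 M" for U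
      proof -
        have "ae_eq M (U f) (U (g m) + U (r m))"
          using BL2_add[OF U g r] gr(3)[of m] by simp
        then have "L2_inner M (U f) h = L2_inner M (U (g m) + U (r m)) h"
          using f g r h by (intro L2_inner_cong L2_add BL2_L2[OF U]) auto
        then show ?thesis using g r h by (simp add: L2_inner_add_left BL2_L2[OF U])
      qed
      moreover have "L2_inner M (S (g m)) h = L2_inner M (T (g m)) h"
        using g h by (intro L2_inner_cong mem eq gr(1)) auto
      ultimately have "?d = L2_inner M (S (r m)) h - L2_inner M (T (r m)) h"
        using S T by simp
      also have "norm \<dots> \<le> norm (L2_inner M (S (r m)) h) + norm (L2_inner M (T (r m)) h)"
        by (rule norm_triangle_ineq4)
      also have "\<dots> \<le> L2_norm M (S (r m)) * L2_norm M h + L2_norm M (T (r m)) * L2_norm M h"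
        using r h by (intro add_mono L2_Cauchy_Schwarz mem)
      also have "\<dots> \<le> K * L2_norm M (r m) * L2_norm M h + L * L2_norm M (r m) * L2_norm M h"
        using r by (intro add_mono mult_right_mono K L) auto
      also have "\<dots> = (K + L) * L2_norm M h * L2_norm M (r m)"
        by (simp add: algebra_simps)
      finally show ?thesis .
    qed
    have "(\<lambda>m. (K + L) * L2_norm M h * L2_norm M (r m)) \<longlonglongrightarrow> 0"
      using tendsto_mult_right_zero[OF gr(4)] .
    then have "norm ?d \<le> 0" using le by (intro LIMSEQ_le_const) auto
    then show "L2_inner M (S f) h = L2_inner M (T f) h" by simp
  qed (use f mem in auto)
qed

text \<open>
  L-infinity is a maximal commutative subalgebra of the bounded operators. The symbol must be \<open>R 1\<close>,
  since \<open>R a = R (a 1) = a R 1\<close>. It is essentially bounded: on the indicator of the set where its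
  modulus exceeds \<open>K + 1\<close>, the operator \<open>R\<close> would expand the norm by at least the factor \<open>K + 1\<close>, although
  \<open>K\<close> is a bound for \<open>R\<close>; so that indicator is null.
\<close>

lemma mult_op_if_commutes:
  assumes R: "R \<in> BL2 M"
    and comm: "\<And>a. a \<in> Linf M \<Longrightarrow> op_eq M (R \<circ> mult_op a) (mult_op a \<circ> R)"
  obtains b where "b \<in> Linf M" "op_eq M R (mult_op b)"
proof -
  define b where "b = R 1"
  have b: "b \<in> L2 M" unfolding b_def by (rule BL2_L2[OF R]) simp
  have Ra: "ae_eq M (R a) (a * b)" if "a \<in> Linf M" for a
  proof -
    have "a * 1 = a" by (simp add: fun_eq_iff)
    then show ?thesis using op_eqD[OF comm[OF that] one_L2] by (simp add: mult_op_def b_def)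
  qed
  obtain K where K: "0 \<le> K" "\<And>f. f \<in> L2 M \<Longrightarrow> L2_norm M (R f) \<le> K * L2_norm M f"
    using BL2_bound[OF R] by blast
  define E where "E = {x \<in> space M. K + 1 < norm (b x)}"
  define f where "f = (indicator E :: _ \<Rightarrow> complex)"
  have [measurable]: "b \<in> borel_measurable M" using b by (rule L2D)
  have E: "E \<in> sets M" unfolding E_def by measurable
  have f: "f \<in> Linf M" unfolding f_def using E by (rule indicator_Linf)
  note fL = Linf_L2[OF f]
  have fb: "f * b \<in> L2 M" using f b by (rule Linf_mult_L2)
  have "norm (f x) \<le> 1 / (K + 1) * norm ((f * b) x)" for x
    using K(1) by (auto simp: f_def indicator_def E_def field_simps)
  then have "L2_norm M f \<le> 1 / (K + 1) * L2_norm M (f * b)"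
    using K(1) fb fL by (intro L2_norm_mono(2)) (auto intro: L2D)
  also have "L2_norm M (f * b) = L2_norm M (R f)"
    using fb fL by (intro L2_norm_cong BL2_L2[OF R] ae_eq_sym[OF Ra[OF f]])
  also have "1 / (K + 1) * L2_norm M (R f) \<le> 1 / (K + 1) * (K * L2_norm M f)"
    using K fL by (intro mult_left_mono) auto
  finally have "L2_norm M f = 0"
    using K(1) L2_norm_nonneg[of M f] by (simp add: field_simps)
  then have "AE x in M. f x = 0" using L2_norm_eq_0_iff[OF fL] by (simp add: ae_eq_def)
  then have "AE x in M. norm (b x) \<le> K + 1"
    using AE_space by eventually_elim (auto simp: f_def E_def indicator_def not_less split: if_splits)
  then have bL: "b \<in> Linf M" by (auto simp: Linf_def)
  have "op_eq M R (mult_op b)"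
  proof (rule op_eq_if_eq_on_Linf[OF R BL2_mult_op[OF bL]])
    show "ae_eq M (R a) (mult_op b a)" if "a \<in> Linf M" for a
      using Ra[OF that] by (simp add: mult_op_def mult.commute)
  qed
  then show ?thesis using bL that by blast
qed

lemma op_eq_mult_op_iff: "op_eq M (mult_op a) (mult_op b) \<longleftrightarrow> ae_eq M a b"
proof
  assume "op_eq M (mult_op a) (mult_op b)"
  from op_eqD[OF this one_L2] show "ae_eq M a b"
    by (simp add: mult_op_def times_fun_def)
next
  assume "ae_eq M a b"
  then show "op_eq M (mult_op a) (mult_op b)"
    by (simp add: op_eq_def mult_op_def ae_eq_mult)
qed

end

lemma op_symbol_eq:
  assumes "b \<in> Linf M" "op_eq M R (mult_op b)"
  shows "op_symbol M R \<in> Linf M" "op_eq M R (mult_op (op_symbol M R))"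
  using someI[of "\<lambda>b. b \<in> Linf M \<and> op_eq M R (mult_op b)" b] assms
  unfolding op_symbol_def by auto

text \<open>
  A literal equality of functions, not only almost everywhere: the two choices are made from the same
  predicate. It allows symbols to be exchanged inside further constructions without any congruence
  argument for \<open>alpha\<close>.
\<close>

lemma op_symbol_cong:
  assumes "op_eq M R R'"
  shows "op_symbol M R = op_symbol M R'"
proof -
  have "op_eq M R T \<longleftrightarrow> op_eq M R' T" for T
    using assms by (meson op_eq_sym op_eq_trans)
  then show ?thesis by (simp add: op_symbol_def)
qed

section \<open>Uniqueness of positive square roots\<close>

lemma BL2_lin:
  assumes T: "T \<in> BL2 M" and f: "f \<in> L2 M" and g: "g \<in> L2 M"
  shows "ae_eq M (T ((\<lambda>x. c * f x) + (\<lambda>x. d * g x))) ((\<lambda>x. c * T f x) + (\<lambda>x. d * T g x))"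
  using ae_eq_trans[OF BL2_add[OF T L2_scale[OF f] L2_scale[OF g]]
      ae_eq_add[OF BL2_scale[OF T f] BL2_scale[OF T g]]] .

lemma positive_op_shift_bound:
  assumes A: "positive_op M A" and u: "u \<in> L2 M" and t: "0 \<le> t"
  shows "t * L2_norm M u \<le> L2_norm M ((\<lambda>x. of_real t * u x) + A u)"
proof (rule power2_le_imp_le)
  have AB: "A \<in> BL2 M" and pos: "0 \<le> Re (L2_inner M (A u) u)"
    using A u by (auto simp: positive_op_def)
  have "(L2_norm M (\<lambda>x. of_real t * u x))\<^sup>2 = (t * L2_norm M u)\<^sup>2"
    by (simp add: L2_norm_power2 power_mult_distrib norm_mult)
  moreover have "Re (L2_inner M (\<lambda>x. of_real t * u x) (A u)) = t * Re (L2_inner M (A u) u)"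
    by (simp add: L2_inner_scale_left L2_inner_commute[of M u "A u"])
  ultimately show "(t * L2_norm M u)\<^sup>2 \<le> (L2_norm M ((\<lambda>x. of_real t * u x) + A u))\<^sup>2"
    using L2_norm_add_power2[OF L2_scale[OF u] BL2_L2[OF AB u], of "of_real t"] pos t
    by simp
qed simp

text \<open>
  The difference \<open>X = A - B\<close> satisfies \<open>A X = - X B\<close>, because \<open>A\<^sup>2 = B\<^sup>2\<close>; hence \<open>(A + t) X = X (t - B)\<close>
  for every \<open>t\<close>. The left factor expands norms by at least \<open>t\<close>, by positivity of \<open>A\<close>, and \<open>t - B\<close> has norm
  at most \<open>q < t\<close>. Any bound \<open>K\<close> for \<open>X\<close> can therefore be improved to \<open>K q / t\<close>, and iteration gives
  \<open>X = 0\<close>. If \<open>B\<close> is multiplication by a function with values in \<open>[c, t]\<close>, where \<open>0 < c\<close>, then the bound on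
  \<open>t - B\<close> holds with \<open>q = t - c\<close>.
\<close>

lemma positive_sqrt_unique:
  assumes A: "positive_op M A" and B: "B \<in> BL2 M"
    and sq: "op_eq M (A \<circ> A) (B \<circ> B)"
    and q: "0 \<le> q" "q < t"
    and Bq: "\<And>f. f \<in> L2 M \<Longrightarrow>
      L2_norm M ((\<lambda>x. of_real t * f x) + (\<lambda>x. -1 * B f x)) \<le> q * L2_norm M f"
  shows "op_eq M A B"
proof -
  have AB: "A \<in> BL2 M" using A by (simp add: positive_op_def)
  define X where "X = A + (mult_op (\<lambda>x. -1) \<circ> B)"
  have XB: "X \<in> BL2 M"
    unfolding X_def by (intro BL2_plus BL2_comp BL2_mult_op AB B Linf_const)
  have X: "X f x = A f x - B f x" for f x
    by (simp add: X_def mult_op_def)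
  have t: "0 < t" using q by simp
  have contract: "t * L2_norm M (X f) \<le> L2_norm M (X ((\<lambda>x. of_real t * f x) + (\<lambda>x. -1 * B f x)))"
    if f: "f \<in> L2 M" for f
  proof -
    \<comment> \<open>\<open>g\<close> is \<open>(t - B) f\<close>, and the goal is \<open>X g = (A + t) X f\<close>.\<close>
    define g where "g = (\<lambda>x. of_real t * f x) + (\<lambda>x. -1 * B f x)"
    note Bf = BL2_L2[OF B f] and Af = BL2_L2[OF AB f] and Xf = BL2_L2[OF XB f]
    have g: "g \<in> L2 M" unfolding g_def by (intro L2_add L2_scale f Bf)
    have X': "X f = (\<lambda>x. 1 * A f x) + (\<lambda>x. -1 * B f x)" by (simp add: fun_eq_iff X)
    have "ae_eq M (X g) ((\<lambda>x. of_real t * X f x) + A (X f))"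
      using BL2_lin[OF AB f Bf, of "of_real t" "-1"] BL2_lin[OF B f Bf, of "of_real t" "-1"]
        BL2_lin[OF AB Af Bf, of 1 "-1"] op_eqD[OF sq f]
      unfolding X'[symmetric] g_def[symmetric] unfolding ae_eq_def
    proof eventually_elim
      case (elim x)
      have eqs: "A g x = of_real t * A f x - A (B f) x" "B g x = of_real t * B f x - B (B f) x"
        "A (X f) x = B (B f) x - A (B f) x"
        using elim by simp_all
      show ?case by (simp only: plus_fun_apply X eqs) (simp add: right_diff_distrib)
    qed
    then have "L2_norm M (X g) = L2_norm M ((\<lambda>x. of_real t * X f x) + A (X f))"
      by (intro L2_norm_cong L2_add L2_scale BL2_L2[OF XB] BL2_L2[OF AB] g f)
    with positive_op_shift_bound[OF A Xf, of t] t show ?thesis by (simp add: g_def)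
  qed
  obtain K where K: "0 \<le> K" "\<And>f. f \<in> L2 M \<Longrightarrow> L2_norm M (X f) \<le> K * L2_norm M f"
    using BL2_bound[OF XB] by blast
  have bound: "L2_norm M (X f) \<le> K * (q / t) ^ m * L2_norm M f" if "f \<in> L2 M" for f m
    using that
  proof (induction m arbitrary: f)
    case (Suc m)
    let ?g = "(\<lambda>x. of_real t * f x) + (\<lambda>x. -1 * B f x)"
    have g: "?g \<in> L2 M" by (intro L2_add L2_scale Suc.prems BL2_L2[OF B])
    have "t * L2_norm M (X f) \<le> K * (q / t) ^ m * L2_norm M ?g"
      using contract[OF Suc.prems] Suc.IH[OF g] by linarith
    also have "\<dots> \<le> K * (q / t) ^ m * (q * L2_norm M f)"
      using K(1) q t by (intro mult_left_mono Bq Suc.prems) auto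
    finally show ?case using t by (simp add: field_simps)
  qed (use K in simp)
  show ?thesis
    unfolding op_eq_def
  proof
    fix f assume f: "f \<in> L2 M"
    have lim: "(\<lambda>m. (q / t) ^ m) \<longlonglongrightarrow> 0"
      using q t by (intro LIMSEQ_realpow_zero) auto
    have "(\<lambda>m. K * (q / t) ^ m * L2_norm M f) \<longlonglongrightarrow> K * 0 * L2_norm M f"
      by (rule tendsto_mult_right[OF tendsto_mult_left[OF lim]])
    then have "L2_norm M (X f) \<le> K * 0 * L2_norm M f"
      using bound[OF f] by (intro LIMSEQ_le_const) auto
    then have "L2_norm M (X f) = 0" using L2_norm_nonneg[of M "X f"] by simp
    then have "ae_eq M (X f) 0" using L2_norm_eq_0_iff[OF BL2_L2[OF XB f]] by simp
    then show "ae_eq M (A f) (B f)"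
      unfolding ae_eq_def by eventually_elim (simp add: X)
  qed
qed

section \<open>Bounds for the symbol of a multiplication operator\<close>

context finite_measure
begin

lemma AE_nonpos_if_integrals_nonpos:
  fixes u :: "'a \<Rightarrow> real"
  assumes u: "integrable M u" and le: "\<And>E. E \<in> sets M \<Longrightarrow> (LINT x|M. u x * indicator E x) \<le> 0"
  shows "AE x in M. u x \<le> 0"
proof -
  have [measurable]: "u \<in> borel_measurable M" using u by simp
  define E where "E = {x \<in> space M. 0 < u x}"
  have E: "E \<in> sets M" unfolding E_def by measurable
  have i: "integrable M (\<lambda>x. u x * indicator E x)"
    using integrable_real_mult_indicator[OF E u] .
  have nn: "AE x in M. 0 \<le> u x * indicator E x"
    by (auto simp: E_def indicator_def)
  have "(LINT x|M. u x * indicator E x) = 0"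
    using le[OF E] integral_nonneg_AE[OF nn] by linarith
  then have "AE x in M. u x * indicator E x = 0"
    using integral_nonneg_eq_0_iff_AE[OF i nn] by simp
  then show ?thesis
    using AE_space by eventually_elim (auto simp: E_def indicator_def split: if_splits)
qed

text \<open>
  Bounds for the quadratic form of a multiplication operator pass to its symbol: on the indicator of
  \<open>E\<close> the form is the integral of \<open>b\<close> over \<open>E\<close>, and \<open>E\<close> is arbitrary.
\<close>

lemma symbol_bounded_below:
  assumes b: "b \<in> Linf M"
    and ge: "\<And>f. f \<in> L2 M \<Longrightarrow> L2_inner M (b * f) f \<in> \<real> \<and> d * (L2_norm M f)\<^sup>2 \<le> Re (L2_inner M (b * f) f)"
  shows "AE x in M. b x \<in> \<real> \<and> d \<le> Re (b x)"
proof -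
  have bI: "integrable M b"
    using L2_prod_integrable[OF Linf_L2[OF b] one_L2] by simp
  have inner: "L2_inner M (b * indicator E) (indicator E) = (LINT x|M. b x * of_real (indicator E x))"
    and intE: "integrable M (\<lambda>x. b x * of_real (indicator E x))"
    and real: "(LINT x|M. Im (b x) * indicator E x) = 0"
    and lower: "d * measure M E \<le> (LINT x|M. Re (b x) * indicator E x)"
    if E: "E \<in> sets M" for E
  proof -
    show inner: "L2_inner M (b * indicator E) (indicator E) = (LINT x|M. b x * of_real (indicator E x))"
      unfolding L2_inner_def by (intro Bochner_Integration.integral_cong) (auto simp: indicator_def)
    have eL: "(indicator E :: 'a \<Rightarrow> complex) \<in> L2 M" by (rule Linf_L2[OF indicator_Linf[OF E]])
    show intE: "integrable M (\<lambda>x. b x * of_real (indicator E x))"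
      using L2_prod_integrable[OF Linf_L2[OF b] eL] by (simp add: of_real_indicator)
    have re: "Re (LINT x|M. b x * of_real (indicator E x)) = (LINT x|M. Re (b x) * indicator E x)"
      and im: "Im (LINT x|M. b x * of_real (indicator E x)) = (LINT x|M. Im (b x) * indicator E x)"
      using Bochner_Integration.integral_Re[OF intE] Bochner_Integration.integral_Im[OF intE] by simp_all
    have "(L2_norm M (indicator E))\<^sup>2 = (LINT x|M. indicator E x)"
      unfolding L2_norm_power2 by (intro Bochner_Integration.integral_cong) (auto simp: indicator_def)
    then have "(L2_norm M (indicator E))\<^sup>2 = measure M E" using E by simp
    then show "(LINT x|M. Im (b x) * indicator E x) = 0"
      "d * measure M E \<le> (LINT x|M. Re (b x) * indicator E x)"
      using ge[OF eL] unfolding inner re[symmetric] im[symmetric] by (auto simp: complex_is_Real_iff)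
  qed
  have "AE x in M. Im (b x) \<le> 0"
    using bI real by (intro AE_nonpos_if_integrals_nonpos) auto
  moreover have "AE x in M. - Im (b x) \<le> 0"
    using bI real by (intro AE_nonpos_if_integrals_nonpos) auto
  moreover have "AE x in M. d - Re (b x) \<le> 0"
  proof (rule AE_nonpos_if_integrals_nonpos)
    fix E assume E: "E \<in> sets M"
    have i: "integrable M (\<lambda>x. Re (b x) * indicator E x)"
      using integrable_real_mult_indicator[OF E, of "\<lambda>x. Re (b x)"] bI by auto
    have "(LINT x|M. (d - Re (b x)) * indicator E x) = (LINT x|M. d * indicator E x - Re (b x) * indicator E x)"
      by (simp add: algebra_simps)
    also have "\<dots> = (LINT x|M. d * indicator E x) - (LINT x|M. Re (b x) * indicator E x)"
      using E i by (intro Bochner_Integration.integral_diff) (auto simp: less_top[symmetric])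
    also have "(LINT x|M. d * indicator E x) = d * measure M E" using E by simp
    finally show "(LINT x|M. (d - Re (b x)) * indicator E x) \<le> 0"
      using lower[OF E] by simp
  qed (use bI in auto)
  ultimately show ?thesis
    by eventually_elim (auto simp: complex_is_Real_iff)
qed

end

section \<open>The adjoint of a composition operator\<close>

locale composition = finite_measure M for M :: "'a measure" +
  fixes \<phi> :: "'a \<Rightarrow> 'a"
  assumes \<phi> [measurable]: "\<phi> \<in> M \<rightarrow>\<^sub>M M"
    and comp_BL2: "comp_op \<phi> \<in> BL2 M"
begin

text \<open>
  Well-definedness of the composition operator on classes of functions means that \<open>\<phi>\<close> is nonsingular:
  the indicator of a null set represents \<open>0\<close>, hence so does its composition with \<open>\<phi>\<close>.
\<close>

lemma AE_compose:
  assumes "AE x in M. Q x"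
  shows "AE x in M. Q (\<phi> x)"
proof -
  obtain N where N: "N \<in> null_sets M" "{x \<in> space M. \<not> Q x} \<subseteq> N"
    using assms by (auto simp: eventually_ae_filter)
  have "AE x in M. (indicator N x :: complex) = 0"
    using AE_not_in[OF N(1)] by eventually_elim (simp add: indicator_def)
  moreover have "(indicator N :: 'a \<Rightarrow> complex) \<in> L2 M"
    using N by (intro Linf_L2 indicator_Linf) auto
  ultimately have "ae_eq M (comp_op \<phi> (indicator N)) (comp_op \<phi> 0)"
    by (intro BL2_cong[OF comp_BL2]) (auto simp: ae_eq_def)
  then have "AE x in M. (indicator N (\<phi> x) :: complex) = 0"
    by (simp add: ae_eq_def comp_op_def)
  then show ?thesis
    using AE_space by eventually_elim
      (use N measurable_space[OF \<phi>] in \<open>auto simp: indicator_def split: if_splits\<close>)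
qed

lemma alpha_Linf:
  assumes "a \<in> Linf M"
  shows "alpha \<phi> a \<in> Linf M"
proof -
  obtain K where "AE x in M. norm (a x) \<le> K" using assms by (rule LinfE)
  from AE_compose[OF this] show ?thesis
    using assms by (auto simp: Linf_def alpha_def comp_def)
qed

text \<open>
  The value of the adjoint at a nonnegative \<open>g\<close> is the Radon-Nikodym derivative \<open>k\<close> of the image under
  \<open>\<phi>\<close> of the measure with density \<open>g\<close>. That \<open>k\<close> is square-integrable is a duality argument: the truncations
  \<open>s m = min k m\<close> satisfy \<open>\<parallel>s m\<parallel>\<^sup>2 \<le> \<integral> (s m) k = \<langle>C (s m), g\<rangle> \<le> K \<parallel>s m\<parallel> \<parallel>g\<parallel>\<close>, so their norms are bounded
  by \<open>K \<parallel>g\<parallel>\<close>, and Fatou's lemma carries the bound to \<open>k\<close>.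
\<close>

lemma adjoint_at_nonneg:
  assumes g: "(\<lambda>x. complex_of_real (g x)) \<in> L2 M" and nn: "\<And>x. 0 \<le> g x"
  shows "\<exists>k\<in>L2 M. \<forall>f\<in>L2 M. L2_inner M (comp_op \<phi> f) (\<lambda>x. of_real (g x)) = L2_inner M f k"
proof -
  let ?g = "\<lambda>x. complex_of_real (g x)"
  have "(\<lambda>x. Re (?g x)) \<in> borel_measurable M" using L2D(1)[OF g] by measurable
  then have gm [measurable]: "g \<in> borel_measurable M" by simp
  have "integrable M (\<lambda>x. ?g x * 1 x)" by (rule L2_prod_integrable[OF g one_L2])
  then have "integrable M (\<lambda>x. Re (?g x * 1 x))" by (rule integrable_Re)
  then have gi: "integrable M g" by simp
  define N where "N = distr (density M (\<lambda>x. ennreal (g x))) M \<phi>"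
  have \<phi>d [measurable]: "\<phi> \<in> density M (\<lambda>x. ennreal (g x)) \<rightarrow>\<^sub>M M" by simp
  have "emeasure N (space N) = (\<integral>\<^sup>+x. ennreal (g x) \<partial>M)"
    using measurable_space[OF \<phi>]
    by (auto simp: N_def emeasure_distr emeasure_density intro!: nn_integral_cong)
  also have "\<dots> < \<infinity>" using gi nn by (simp add: nn_integral_eq_integral)
  finally interpret N: finite_measure N by (intro finite_measureI) simp
  have setsN: "sets N = sets M" by (simp add: N_def)
  have ac: "absolutely_continuous M N"
    unfolding absolutely_continuous_def
  proof
    fix E assume E: "E \<in> null_sets M"
    then have "AE x in M. \<phi> x \<notin> E" by (intro AE_compose AE_not_in)
    then have "AE x in M. ennreal (g x) * indicator (\<phi> -` E \<inter> space M) x = 0"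
      by eventually_elim (simp add: indicator_def)
    then have "emeasure N E = 0"
      using E by (auto simp: N_def emeasure_distr emeasure_density nn_integral_0_iff_AE)
    then show "E \<in> null_sets N" using E setsN by auto
  qed
  define k where "k x = enn2real (RN_deriv M N x)" for x
  have km [measurable]: "k \<in> borel_measurable M" unfolding k_def by measurable
  have knn: "0 \<le> k x" for x by (simp add: k_def)
  have "AE x in M. RN_deriv M N x \<noteq> \<infinity>"
    by (rule RN_deriv_finite[OF N.sigma_finite_measure_axioms ac setsN])
  then have "AE x in M. ennreal (k x) = RN_deriv M N x"
    by eventually_elim (simp add: k_def less_top[symmetric])
  then have "density M (\<lambda>x. ennreal (k x)) = density M (RN_deriv M N)"
    by (intro density_cong) auto
  then have kN: "density M (\<lambda>x. ennreal (k x)) = N"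
    using density_RN_deriv[OF ac setsN] by simp
  have ki: "integrable M k"
    using N.emeasure_finite[of "space N"] knn setsN unfolding kN[symmetric]
    by (auto simp: emeasure_density integrable_iff_bounded less_top[symmetric] cong: nn_integral_cong)
  \<comment> \<open>Both sides are the integral of \<open>f\<close> over the image measure.\<close>
  have dual: "(LINT x|M. f (\<phi> x) * ?g x) = (LINT x|M. f x * of_real (k x))"
    if f [measurable]: "f \<in> borel_measurable M" for f :: "'a \<Rightarrow> complex"
  proof -
    have "(LINT x|M. f (\<phi> x) * ?g x) = (LINT x|density M (\<lambda>x. ennreal (g x)). f (\<phi> x))"
      using nn by (subst integral_density) (auto simp: scaleR_conv_of_real mult.commute)
    also have "\<dots> = (LINT x|N. f x)"
      unfolding N_def by (rule integral_distr[symmetric]) auto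
    also have "\<dots> = (LINT x|M. f x * of_real (k x))"
      unfolding kN[symmetric] using knn
      by (subst integral_density) (auto simp: scaleR_conv_of_real mult.commute)
    finally show ?thesis .
  qed
  obtain K where K: "0 \<le> K" "\<And>f. f \<in> L2 M \<Longrightarrow> L2_norm M (comp_op \<phi> f) \<le> K * L2_norm M f"
    using BL2_bound[OF comp_BL2] by blast
  let ?B = "K * L2_norm M ?g"
  define s where "s m x = min (k x) (real m)" for m x
  have sm [measurable]: "s m \<in> borel_measurable M" for m unfolding s_def by measurable
  have snn: "0 \<le> s m x" for m x using knn by (simp add: s_def)
  have sL: "(\<lambda>x. complex_of_real (s m x)) \<in> L2 M" for m
    by (intro Linf_L2) (use snn in \<open>auto simp: Linf_def s_def intro!: exI[of _ "real m"]\<close>)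
  have s_norm: "L2_norm M (\<lambda>x. complex_of_real (s m x)) \<le> ?B" for m
  proof -
    let ?s = "\<lambda>x. complex_of_real (s m x)"
    have "integrable M (\<lambda>x. real m * k x)" using ki by simp
    then have i: "integrable M (\<lambda>x. s m x * k x)"
      by (rule Bochner_Integration.integrable_bound)
        (use snn knn in \<open>auto simp: s_def abs_mult intro!: mult_right_mono\<close>)
    have "(L2_norm M ?s)\<^sup>2 = (LINT x|M. s m x * s m x)"
      unfolding L2_norm_power2 by (simp add: power2_eq_square)
    also have "\<dots> \<le> (LINT x|M. s m x * k x)"
      using L2D(2)[OF sL[of m]] i snn
      by (intro integral_mono) (auto simp: power2_eq_square s_def intro!: mult_left_mono)
    also have "\<dots> = Re (LINT x|M. ?s x * of_real (k x))"
      by (simp flip: of_real_mult)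
    also have "\<dots> = Re (L2_inner M (comp_op \<phi> ?s) ?g)"
      by (subst dual[symmetric]) (auto simp: L2_inner_def comp_op_def)
    also have "\<dots> \<le> L2_norm M (comp_op \<phi> ?s) * L2_norm M ?g"
      using L2_Cauchy_Schwarz[OF BL2_L2[OF comp_BL2 sL] g] complex_Re_le_cmod order_trans by blast
    also have "\<dots> \<le> K * L2_norm M ?s * L2_norm M ?g"
      by (intro mult_right_mono K sL) simp
    finally have le: "L2_norm M ?s * L2_norm M ?s \<le> L2_norm M ?s * ?B"
      by (simp add: power2_eq_square mult_ac)
    show ?thesis
    proof (cases "L2_norm M ?s = 0")
      case False
      then have "0 < L2_norm M ?s" using L2_norm_nonneg[of M ?s] by linarith
      then show ?thesis using le by simp
    qed (use K in simp)
  qed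
  have "(\<integral>\<^sup>+x. ennreal ((k x)\<^sup>2) \<partial>M) \<le> (\<integral>\<^sup>+x. liminf (\<lambda>m. ennreal ((s m x)\<^sup>2)) \<partial>M)"
  proof (rule nn_integral_mono)
    fix x
    obtain m0 where m0: "k x \<le> real m0" using real_arch_simple[of "k x"] by blast
    have "eventually (\<lambda>m. ennreal ((s m x)\<^sup>2) = ennreal ((k x)\<^sup>2)) sequentially"
      using eventually_ge_at_top[of m0]
    proof eventually_elim
      case (elim m)
      then have "k x \<le> real m" using m0 by linarith
      then show ?case by (simp add: s_def)
    qed
    then have "(\<lambda>m. ennreal ((s m x)\<^sup>2)) \<longlonglongrightarrow> ennreal ((k x)\<^sup>2)" by (rule tendsto_eventually)
    from lim_imp_Liminf[OF trivial_limit_sequentially this]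
    show "ennreal ((k x)\<^sup>2) \<le> liminf (\<lambda>m. ennreal ((s m x)\<^sup>2))" by simp
  qed
  also have "\<dots> \<le> liminf (\<lambda>m. \<integral>\<^sup>+x. ennreal ((s m x)\<^sup>2) \<partial>M)"
    by (rule nn_integral_liminf) measurable
  also have "\<dots> \<le> ennreal (?B\<^sup>2)"
  proof (rule Liminf_le)
    have "(\<integral>\<^sup>+x. ennreal ((s m x)\<^sup>2) \<partial>M) \<le> ennreal (?B\<^sup>2)" for m
    proof -
      have "(\<integral>\<^sup>+x. ennreal ((s m x)\<^sup>2) \<partial>M) = ennreal ((L2_norm M (\<lambda>x. complex_of_real (s m x)))\<^sup>2)"
        unfolding L2_norm_power2 using L2D(2)[OF sL[of m]]
        by (subst nn_integral_eq_integral) auto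
      also have "\<dots> \<le> ennreal (?B\<^sup>2)"
        by (intro ennreal_leI power_mono s_norm) simp
      finally show ?thesis .
    qed
    then show "\<forall>\<^sub>F m in sequentially. (\<integral>\<^sup>+x. ennreal ((s m x)\<^sup>2) \<partial>M) \<le> ennreal (?B\<^sup>2)" by simp
  qed simp
  finally have "(\<integral>\<^sup>+x. ennreal ((k x)\<^sup>2) \<partial>M) < \<infinity>" by (rule le_less_trans) simp
  then have kL: "(\<lambda>x. complex_of_real (k x)) \<in> L2 M"
    by (auto simp: L2_def integrable_iff_bounded)
  then show ?thesis
    by (intro bexI[OF _ kL] ballI) (simp add: L2_inner_def comp_op_def dual[OF L2D(1)])
qed

text \<open>
  The functions at which an adjoint value exists form a linear space, and every \<open>g\<close> in L2 is a
  combination of the positive and negative parts of its real and imaginary parts.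
\<close>

lemma adjoint_exists:
  obtains C' where "is_adjoint M (comp_op \<phi>) C'"
proof -
  define Q where "Q g \<longleftrightarrow> g \<in> L2 M \<and> (\<exists>k\<in>L2 M. \<forall>f\<in>L2 M. L2_inner M (comp_op \<phi> f) g = L2_inner M f k)" for g
  have Q_add: "Q (g + h)" if gh: "Q g" "Q h" for g h
  proof -
    obtain k l where k: "g \<in> L2 M" "k \<in> L2 M" "\<forall>f\<in>L2 M. L2_inner M (comp_op \<phi> f) g = L2_inner M f k"
      and l: "h \<in> L2 M" "l \<in> L2 M" "\<forall>f\<in>L2 M. L2_inner M (comp_op \<phi> f) h = L2_inner M f l"
      using gh by (auto simp: Q_def)
    show ?thesis unfolding Q_def using k l
      by (intro conjI L2_add bexI[of _ "k + l"]) (auto simp: L2_inner_add_right BL2_L2[OF comp_BL2])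
  qed
  have Q_scale: "Q (\<lambda>x. c * g x)" if g: "Q g" for g c
  proof -
    obtain k where k: "g \<in> L2 M" "k \<in> L2 M" "\<forall>f\<in>L2 M. L2_inner M (comp_op \<phi> f) g = L2_inner M f k"
      using g by (auto simp: Q_def)
    show ?thesis unfolding Q_def using k
      by (intro conjI L2_scale bexI[of _ "\<lambda>x. c * k x"]) (auto simp: L2_inner_scale_right)
  qed
  have Q: "Q g" if g: "g \<in> L2 M" for g
  proof -
    have part: "Q (\<lambda>x. complex_of_real (max 0 (u (g x))))"
      if u: "\<And>z. \<bar>u z\<bar> \<le> norm z" "u \<in> borel_measurable borel" for u :: "complex \<Rightarrow> real"
    proof -
      have [measurable]: "g \<in> borel_measurable M" "u \<in> borel_measurable borel"
        using L2D(1)[OF g] u by auto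
      have "norm (complex_of_real (max 0 (u z))) \<le> 1 * norm z" for z
        using u(1)[of z] by (auto simp: max_def)
      then have "(\<lambda>x. complex_of_real (max 0 (u (g x)))) \<in> L2 M"
        using g by (intro L2_norm_mono(1)[where K = 1, OF _ g]) auto
      then show ?thesis unfolding Q_def using adjoint_at_nonneg by auto
    qed
    let ?p = "\<lambda>u x. complex_of_real (max 0 (u (g x)))"
    have "Q ((?p Re + (\<lambda>x. -1 * ?p (\<lambda>z. - Re z) x))
        + (\<lambda>x. \<i> * (?p Im + (\<lambda>x. -1 * ?p (\<lambda>z. - Im z) x)) x))"
      by (intro Q_add Q_scale part) (auto simp: abs_Re_le_cmod abs_Im_le_cmod)
    also have "(?p Re + (\<lambda>x. -1 * ?p (\<lambda>z. - Re z) x))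
        + (\<lambda>x. \<i> * (?p Im + (\<lambda>x. -1 * ?p (\<lambda>z. - Im z) x)) x) = g"
      by (auto simp: fun_eq_iff complex_eq_iff max_def)
    finally show ?thesis .
  qed
  then have "\<forall>g\<in>L2 M. \<exists>k. k \<in> L2 M \<and> (\<forall>f\<in>L2 M. L2_inner M (comp_op \<phi> f) g = L2_inner M f k)"
    unfolding Q_def by blast
  then obtain C' where "\<forall>g\<in>L2 M. C' g \<in> L2 M \<and> (\<forall>f\<in>L2 M. L2_inner M (comp_op \<phi> f) g = L2_inner M f (C' g))"
    by metis
  then show ?thesis using that is_adjointI[OF comp_BL2, of C'] by blast
qed

end

section \<open>Operators intertwining L-infinity with its image under alpha\<close>

abbreviation intertwiners :: "'a measure \<Rightarrow> ('a \<Rightarrow> 'a) \<Rightarrow> 'a op set" where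
  "intertwiners M \<phi> \<equiv> elems (intertwiner_module M \<phi>)"

lemma intertwiners_iff:
  "T \<in> intertwiners M \<phi> \<longleftrightarrow> T \<in> BL2 M \<and>
     (\<forall>a\<in>Linf M. op_eq M (T \<circ> mult_op a) (mult_op (alpha \<phi> a) \<circ> T))"
  by (simp add: intertwiner_module_def)

lemma alpha_cnj: "alpha \<phi> (\<lambda>x. cnj (a x)) = (\<lambda>x. cnj (alpha \<phi> a x))"
  by (simp add: alpha_def fun_eq_iff)

lemma intertwiners_cong:
  assumes "V \<in> intertwiners M \<phi>" "W \<in> BL2 M" "op_eq M W V"
    and alpha_Linf: "\<And>a. a \<in> Linf M \<Longrightarrow> alpha \<phi> a \<in> Linf M"
  shows "W \<in> intertwiners M \<phi>"
  unfolding intertwiners_iff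
proof (intro conjI ballI)
  fix a assume a: "a \<in> Linf M"
  have V: "V \<in> BL2 M" using assms(1) by (simp add: intertwiners_iff)
  have "op_eq M (W \<circ> mult_op a) (V \<circ> mult_op a)"
    by (rule op_eq_comp_left[OF assms(3) BL2_mult_op[OF a]])
  also have "op_eq M \<dots> (mult_op (alpha \<phi> a) \<circ> V)"
    using assms(1) a by (simp add: intertwiners_iff)
  also have "op_eq M \<dots> (mult_op (alpha \<phi> a) \<circ> W)"
    by (rule op_eq_comp_right[OF op_eq_sym[OF assms(3)] V assms(2) BL2_mult_op[OF alpha_Linf[OF a]]])
  finally show "op_eq M (W \<circ> mult_op a) (mult_op (alpha \<phi> a) \<circ> W)" .
qed (rule assms(2))

text \<open>
  Take adjoints in \<open>T a\<^sup>* = \<alpha>(a\<^sup>*) T\<close>.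
\<close>

lemma adjoint_intertwines:
  assumes alpha_Linf: "\<And>a. a \<in> Linf M \<Longrightarrow> alpha \<phi> a \<in> Linf M"
    and T: "T \<in> intertwiners M \<phi>" and T': "is_adjoint M T T'" and a: "a \<in> Linf M"
  shows "op_eq M (T' \<circ> mult_op (alpha \<phi> a)) (mult_op a \<circ> T')"
proof -
  let ?c = "\<lambda>x. cnj (a x)"
  have c: "?c \<in> Linf M" using a by (rule Linf_cnj)
  have TB: "T \<in> BL2 M" and eq: "op_eq M (T \<circ> mult_op ?c) (mult_op (alpha \<phi> ?c) \<circ> T)"
    using T c unfolding intertwiners_iff by blast+
  have 1: "is_adjoint M (T \<circ> mult_op ?c) (mult_op a \<circ> T')"
    using is_adjoint_comp[OF BL2_mult_op[OF c] T' is_adjoint_mult_op[OF c]] by simp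
  have 2: "is_adjoint M (mult_op (alpha \<phi> ?c) \<circ> T) (T' \<circ> mult_op (alpha \<phi> a))"
    using is_adjoint_comp[OF TB is_adjoint_mult_op[OF alpha_Linf[OF c]] T']
    by (simp add: alpha_cnj)
  have "is_adjoint M (mult_op (alpha \<phi> ?c) \<circ> T) (mult_op a \<circ> T')"
    by (rule is_adjoint_cong[OF eq _ _ 1]) (intro BL2_comp BL2_mult_op TB alpha_Linf c)+
  with 2 show ?thesis by (rule is_adjoint_unique)
qed

text \<open>
  This makes the inner product of the intertwiner module take values in L-infinity:
  \<open>T\<^sup>* V a = T\<^sup>* \<alpha>(a) V = a T\<^sup>* V\<close>, so maximal commutativity applies.
\<close>

lemma (in finite_measure) adjoint_comp_is_mult_op:
  assumes alpha_Linf: "\<And>a. a \<in> Linf M \<Longrightarrow> alpha \<phi> a \<in> Linf M"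
    and T: "T \<in> intertwiners M \<phi>" "is_adjoint M T T'" and V: "V \<in> intertwiners M \<phi>"
  obtains b where "b \<in> Linf M" "op_eq M (T' \<circ> V) (mult_op b)"
proof (rule mult_op_if_commutes)
  have VB: "V \<in> BL2 M" using V by (simp add: intertwiners_iff)
  note TB = is_adjoint_BL2[OF T(2)]
  show "T' \<circ> V \<in> BL2 M" using TB VB by (rule BL2_comp)
  fix a assume a: "a \<in> Linf M"
  have eq: "op_eq M (V \<circ> mult_op a) (mult_op (alpha \<phi> a) \<circ> V)"
    using V a unfolding intertwiners_iff by blast
  have "op_eq M (T' \<circ> (V \<circ> mult_op a)) (T' \<circ> (mult_op (alpha \<phi> a) \<circ> V))"
    by (rule op_eq_comp_right[OF eq _ _ TB]) (intro BL2_comp VB BL2_mult_op alpha_Linf a)+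
  also have "op_eq M \<dots> (mult_op a \<circ> T' \<circ> V)"
    using op_eq_comp_left[OF adjoint_intertwines[OF alpha_Linf T a] VB] by (simp add: comp_assoc)
  finally show "op_eq M (T' \<circ> V \<circ> mult_op a) (mult_op a \<circ> (T' \<circ> V))" by (simp add: comp_assoc)
qed (rule that)

section \<open>Orthonormality and the frame operator\<close>

text \<open>
  What the equivalence uses of the polar factor \<open>S\<close>: it is an intertwiner, it has an adjoint, and some
  \<open>f0\<close> is mapped to the constant function \<open>1\<close>. The last property makes \<open>\<eta>\<close> recoverable from the operator
  \<open>\<eta> S\<close>. The operator \<open>S'\<close> witnesses that an adjoint exists, so that the choice \<open>adj M S\<close> is one.
\<close>

locale intertwiner_family = finite_measure M for M :: "'a measure" +
  fixes \<phi> :: "'a \<Rightarrow> 'a" and S S' :: "'a op" and f0 :: "'a \<Rightarrow> complex"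
    and n :: nat and \<xi> :: "nat \<Rightarrow> 'a \<Rightarrow> complex"
  assumes S_intertwines: "S \<in> intertwiners M \<phi>"
    and S_adjoint: "is_adjoint M S S'"
    and alpha_Linf: "a \<in> Linf M \<Longrightarrow> alpha \<phi> a \<in> Linf M"
    and f0: "f0 \<in> L2 M" and S_f0: "ae_eq M (S f0) 1"
    and \<xi>: "i \<in> {1..n} \<Longrightarrow> \<xi> i \<in> Linf M"
begin

definition T :: "nat \<Rightarrow> 'a op" where
  "T i = mult_op (\<xi> i) \<circ> S"

definition frame_operator :: "'a op" where
  "frame_operator = (\<Sum>i\<in>{1..n}. T i \<circ> adj M (T i))"

lemma S_BL2: "S \<in> BL2 M"
  using S_intertwines by (simp add: intertwiners_iff)

lemma mult_op_S_intertwiner: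
  assumes "\<eta> \<in> Linf M"
  shows "mult_op \<eta> \<circ> S \<in> intertwiners M \<phi>"
proof -
  have "op_eq M (mult_op \<eta> \<circ> (S \<circ> mult_op a)) (mult_op \<eta> \<circ> (mult_op (alpha \<phi> a) \<circ> S))"
    if "a \<in> Linf M" for a
    using S_intertwines that assms
    by (intro op_eq_comp_right BL2_comp BL2_mult_op S_BL2 alpha_Linf) (auto simp: intertwiners_iff)
  moreover have "mult_op \<eta> \<circ> (mult_op b \<circ> S) = mult_op b \<circ> (mult_op \<eta> \<circ> S)" for b
    by (simp add: fun_eq_iff mult_op_def mult_ac)
  ultimately show ?thesis
    using assms by (simp add: intertwiners_iff BL2_comp BL2_mult_op S_BL2 comp_assoc)
qed

lemma T_intertwiner: "i \<in> {1..n} \<Longrightarrow> T i \<in> intertwiners M \<phi>"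
  unfolding T_def by (intro mult_op_S_intertwiner \<xi>)

lemma T_BL2: "i \<in> {1..n} \<Longrightarrow> T i \<in> BL2 M"
  using T_intertwiner by (simp add: intertwiners_iff)

lemma T_adjoint:
  assumes i: "i \<in> {1..n}"
  shows "is_adjoint M (T i) (adj M (T i))"
    and "op_eq M (adj M (T i)) (adj M S \<circ> mult_op (\<lambda>x. cnj (\<xi> i x)))"
proof -
  have *: "is_adjoint M (T i) (adj M S \<circ> mult_op (\<lambda>x. cnj (\<xi> i x)))"
    unfolding T_def
    using i by (intro is_adjoint_comp S_BL2 is_adjoint_mult_op \<xi> is_adjoint_adj[OF S_adjoint])
  show "is_adjoint M (T i) (adj M (T i))" using * by (rule is_adjoint_adj)
  then show "op_eq M (adj M (T i)) (adj M S \<circ> mult_op (\<lambda>x. cnj (\<xi> i x)))"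
    using * by (rule is_adjoint_unique)
qed

lemma adj_T_BL2: "i \<in> {1..n} \<Longrightarrow> adj M (T i) \<in> BL2 M"
  using T_adjoint(1) by (rule is_adjoint_BL2)

lemma frame_operator_BL2: "frame_operator \<in> BL2 M"
  unfolding frame_operator_def by (intro BL2_sum BL2_comp T_BL2 adj_T_BL2)

lemma module_inner_product:
  assumes i: "i \<in> {1..n}" and V: "V \<in> intertwiners M \<phi>"
  shows "op_symbol M (adj M (T i) \<circ> V) \<in> Linf M"
    and "op_eq M (adj M (T i) \<circ> V) (mult_op (op_symbol M (adj M (T i) \<circ> V)))"
proof -
  obtain b where "b \<in> Linf M" "op_eq M (adj M (T i) \<circ> V) (mult_op b)"
    by (rule adjoint_comp_is_mult_op[OF alpha_Linf T_intertwiner[OF i] T_adjoint(1)[OF i] V])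
  then show "op_symbol M (adj M (T i) \<circ> V) \<in> Linf M"
    and "op_eq M (adj M (T i) \<circ> V) (mult_op (op_symbol M (adj M (T i) \<circ> V)))"
    by (rule op_symbol_eq)+
qed

lemma symbol_eq_iff:
  assumes "i \<in> {1..n}" "V \<in> intertwiners M \<phi>"
  shows "ae_eq M (op_symbol M (adj M (T i) \<circ> V)) c \<longleftrightarrow> op_eq M (adj M (T i) \<circ> V) (mult_op c)"
  unfolding op_eq_mult_op_iff[symmetric]
  using module_inner_product(2)[OF assms] by (meson op_eq_sym op_eq_trans)

text \<open>
  Both modules have the same inner products under \<open>\<eta> \<mapsto> \<eta> S\<close>, since
  \<open>T\<^sub>i\<^sup>* (\<eta> S) = S\<^sup>* \<xi>\<^sub>i\<^sup>* \<eta> S\<close>.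
\<close>

lemma transfer_inner_product:
  assumes i: "i \<in> {1..n}" and \<eta>: "\<eta> \<in> Linf M"
  shows "transfer_operator M S ((\<lambda>x. cnj (\<xi> i x)) * \<eta>) = op_symbol M (adj M (T i) \<circ> (mult_op \<eta> \<circ> S))"
proof -
  have "op_eq M (adj M (T i) \<circ> (mult_op \<eta> \<circ> S))
      (adj M S \<circ> mult_op (\<lambda>x. cnj (\<xi> i x)) \<circ> (mult_op \<eta> \<circ> S))"
    using T_adjoint(2)[OF i] \<eta> by (intro op_eq_comp_left BL2_comp BL2_mult_op S_BL2)
  then show ?thesis
    by (auto simp: transfer_operator_def mult_op_mult comp_assoc dest: op_symbol_cong)
qed

lemma expansion_eq_frame_operator:
  assumes V: "V \<in> intertwiners M \<phi>"
  shows "op_eq M (\<Sum>i\<in>{1..n}. T i \<circ> mult_op (op_symbol M (adj M (T i) \<circ> V))) (frame_operator \<circ> V)"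
proof -
  have VB: "V \<in> BL2 M" using V by (simp add: intertwiners_iff)
  have "op_eq M (\<Sum>i\<in>{1..n}. T i \<circ> (adj M (T i) \<circ> V))
      (\<Sum>i\<in>{1..n}. T i \<circ> mult_op (op_symbol M (adj M (T i) \<circ> V)))"
    using VB V
    by (intro op_eq_sum op_eq_comp_right BL2_comp BL2_mult_op module_inner_product T_BL2 adj_T_BL2)
  then show ?thesis by (simp add: frame_operator_def sum_comp comp_assoc op_eq_sym)
qed

lemma mult_op_S_eq_iff:
  assumes "\<eta> \<in> Linf M" "\<zeta> \<in> Linf M"
  shows "op_eq M (mult_op \<eta> \<circ> S) (mult_op \<zeta> \<circ> S) \<longleftrightarrow> ae_eq M \<eta> \<zeta>"
proof
  assume "op_eq M (mult_op \<eta> \<circ> S) (mult_op \<zeta> \<circ> S)"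
  from op_eqD[OF this f0] have "ae_eq M (\<eta> * S f0) (\<zeta> * S f0)"
    by (simp add: mult_op_def)
  then show "ae_eq M \<eta> \<zeta>"
    using S_f0 unfolding ae_eq_def by (auto elim: eventually_elim2)
next
  assume "ae_eq M \<eta> \<zeta>"
  then show "op_eq M (mult_op \<eta> \<circ> S) (mult_op \<zeta> \<circ> S)"
    by (intro op_eq_comp_left S_BL2) (simp add: op_eq_mult_op_iff)
qed

text \<open>
  The embedding \<open>\<eta> \<mapsto> \<eta> S\<close> of L-infinity into the intertwiners is injective and turns the expansion of \<open>\<eta>\<close>
  into that of \<open>\<eta> S\<close>, because \<open>\<xi>\<^sub>i \<alpha>(b) S = \<xi>\<^sub>i S b = T\<^sub>i b\<close>.
\<close>

lemma expansion_in_Linf_iff: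
  assumes \<eta>: "\<eta> \<in> Linf M"
  shows "ae_eq M \<eta> (\<Sum>i\<in>{1..n}. \<xi> i * alpha \<phi> (op_symbol M (adj M (T i) \<circ> (mult_op \<eta> \<circ> S))))
     \<longleftrightarrow> op_eq M (mult_op \<eta> \<circ> S) (frame_operator \<circ> (mult_op \<eta> \<circ> S))"
proof -
  note V = mult_op_S_intertwiner[OF \<eta>]
  define b where "b i = op_symbol M (adj M (T i) \<circ> (mult_op \<eta> \<circ> S))" for i
  have b: "b i \<in> Linf M" if "i \<in> {1..n}" for i
    unfolding b_def using that V by (rule module_inner_product)
  have "op_eq M (T i \<circ> mult_op (b i)) (mult_op (\<xi> i * alpha \<phi> (b i)) \<circ> S)" if i: "i \<in> {1..n}" for i
  proof -
    have eq: "op_eq M (S \<circ> mult_op (b i)) (mult_op (alpha \<phi> (b i)) \<circ> S)"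
      using S_intertwines b[OF i] unfolding intertwiners_iff by blast
    have "op_eq M (mult_op (\<xi> i) \<circ> (S \<circ> mult_op (b i)))
        (mult_op (\<xi> i) \<circ> (mult_op (alpha \<phi> (b i)) \<circ> S))"
      by (rule op_eq_comp_right[OF eq]) (intro BL2_comp BL2_mult_op S_BL2 alpha_Linf b i \<xi>)+
    then show ?thesis by (simp add: T_def mult_op_mult comp_assoc)
  qed
  then have "op_eq M (\<Sum>i\<in>{1..n}. T i \<circ> mult_op (b i))
      (\<Sum>i\<in>{1..n}. mult_op (\<xi> i * alpha \<phi> (b i)) \<circ> S)"
    by (rule op_eq_sum)
  then have *: "op_eq M (frame_operator \<circ> (mult_op \<eta> \<circ> S)) (mult_op (\<Sum>i\<in>{1..n}. \<xi> i * alpha \<phi> (b i)) \<circ> S)"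
    using op_eq_trans[OF op_eq_sym[OF expansion_eq_frame_operator[OF V]]]
    unfolding b_def[symmetric] mult_op_sum[symmetric] sum_comp by blast
  have "(\<Sum>i\<in>{1..n}. \<xi> i * alpha \<phi> (b i)) \<in> Linf M"
    by (intro Linf_sum Linf_mult \<xi> alpha_Linf b)
  from mult_op_S_eq_iff[OF \<eta> this] * show ?thesis
    unfolding b_def[symmetric] by (meson op_eq_sym op_eq_trans)
qed

text \<open>
  Evaluated at \<open>f0\<close>, the hypothesis says that the frame operator fixes \<open>\<eta> S f0 = \<eta>\<close>; density of L-infinity
  does the rest.
\<close>

lemma frame_operator_eq_id_if_fixes_Linf:
  assumes "\<And>\<eta>. \<eta> \<in> Linf M \<Longrightarrow> op_eq M (mult_op \<eta> \<circ> S) (frame_operator \<circ> (mult_op \<eta> \<circ> S))"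
  shows "op_eq M frame_operator id"
proof (rule op_eq_if_eq_on_Linf[OF frame_operator_BL2 BL2_id])
  fix \<eta> assume \<eta>: "\<eta> \<in> Linf M"
  have "ae_eq M (\<eta> * S f0) (\<eta> * 1)" using S_f0 by (intro ae_eq_mult) auto
  then have *: "ae_eq M (\<eta> * S f0) \<eta>" by (simp add: times_fun_def)
  have mem: "\<eta> * S f0 \<in> L2 M" using \<eta> f0 by (intro Linf_mult_L2 BL2_L2[OF S_BL2])
  have "ae_eq M (frame_operator \<eta>) (frame_operator (\<eta> * S f0))"
    by (rule BL2_cong[OF frame_operator_BL2 Linf_L2[OF \<eta>] mem ae_eq_sym[OF *]])
  also have "ae_eq M \<dots> (\<eta> * S f0)"
    using op_eqD[OF assms[OF \<eta>] f0] by (simp add: mult_op_def ae_eq_sym)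
  also note *
  finally show "ae_eq M (frame_operator \<eta>) (id \<eta>)" by simp
qed

lemma frame_operator_comp_eq:
  assumes "op_eq M frame_operator id" "V \<in> BL2 M"
  shows "op_eq M V (frame_operator \<circ> V)"
  using op_eq_sym[OF op_eq_comp_left[OF assms]] by simp

lemma frame_operator_eq_id_iff_fixes_Linf:
  "(\<forall>\<eta>\<in>Linf M. op_eq M (mult_op \<eta> \<circ> S) (frame_operator \<circ> (mult_op \<eta> \<circ> S))) \<longleftrightarrow> op_eq M frame_operator id"
proof (intro iffI ballI)
  show "op_eq M frame_operator id" if "\<forall>\<eta>\<in>Linf M. op_eq M (mult_op \<eta> \<circ> S) (frame_operator \<circ> (mult_op \<eta> \<circ> S))"
    by (rule frame_operator_eq_id_if_fixes_Linf) (rule bspec[OF that])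
qed (intro frame_operator_comp_eq BL2_comp BL2_mult_op S_BL2)

lemma frame_operator_eq_id_iff_fixes_intertwiners:
  "(\<forall>V\<in>intertwiners M \<phi>. op_eq M V (frame_operator \<circ> V)) \<longleftrightarrow> op_eq M frame_operator id"
proof (intro iffI ballI)
  show "op_eq M frame_operator id" if "\<forall>V\<in>intertwiners M \<phi>. op_eq M V (frame_operator \<circ> V)"
    by (rule frame_operator_eq_id_if_fixes_Linf) (rule bspec[OF that mult_op_S_intertwiner])
  show "op_eq M V (frame_operator \<circ> V)" if "op_eq M frame_operator id" "V \<in> intertwiners M \<phi>" for V
    using that by (intro frame_operator_comp_eq) (simp_all add: intertwiners_iff)
qed

text \<open>
  \<open>\<alpha>(a) = \<alpha>(a) \<Sum>\<^sub>i T\<^sub>i T\<^sub>i\<^sup>* = \<Sum>\<^sub>i T\<^sub>i a T\<^sub>i\<^sup>*\<close>.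
\<close>

lemma implements_alpha_if_frame_operator_eq_id:
  assumes id: "op_eq M frame_operator id"
  shows "implements_alpha M \<phi> n T"
  unfolding implements_alpha_def
proof
  fix a assume a: "a \<in> Linf M"
  have "op_eq M (mult_op (alpha \<phi> a) \<circ> T i \<circ> adj M (T i)) (T i \<circ> mult_op a \<circ> adj M (T i))"
    if i: "i \<in> {1..n}" for i
    using T_intertwiner[OF i] a unfolding intertwiners_iff
    by (intro op_eq_comp_left adj_T_BL2 i) (auto intro: op_eq_sym)
  then have "op_eq M (\<Sum>i\<in>{1..n}. mult_op (alpha \<phi> a) \<circ> T i \<circ> adj M (T i))
      (\<Sum>i\<in>{1..n}. T i \<circ> mult_op a \<circ> adj M (T i))"
    by (rule op_eq_sum)
  also have "(\<Sum>i\<in>{1..n}. mult_op (alpha \<phi> a) \<circ> T i \<circ> adj M (T i)) = mult_op (alpha \<phi> a) \<circ> frame_operator"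
    by (simp add: fun_eq_iff mult_op_def frame_operator_def sum_fun_apply sum_distrib_left)
  finally have sum: "op_eq M (mult_op (alpha \<phi> a) \<circ> frame_operator) (\<Sum>i\<in>{1..n}. T i \<circ> mult_op a \<circ> adj M (T i))" .
  have "op_eq M (mult_op (alpha \<phi> a) \<circ> id) (mult_op (alpha \<phi> a) \<circ> frame_operator)"
    by (intro op_eq_comp_right op_eq_sym[OF id] BL2_id frame_operator_BL2 BL2_mult_op alpha_Linf a)
  from op_eq_trans[OF this sum]
  show "op_eq M (mult_op (alpha \<phi> a)) (\<Sum>i\<in>{1..n}. T i \<circ> mult_op a \<circ> adj M (T i))" by simp
qed

definition orthonormal :: bool where
  "orthonormal \<longleftrightarrow>
     (\<forall>i\<in>{1..n}. \<forall>j\<in>{1..n}. op_eq M (adj M (T i) \<circ> T j) (if i = j then id else 0))"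

lemma orthonormal_iff:
  "orthonormal \<longleftrightarrow> (\<forall>i\<in>{1..n}. \<forall>j\<in>{1..n}.
     ae_eq M (op_symbol M (adj M (T i) \<circ> T j)) (if i = j then 1 else 0))"
  unfolding orthonormal_def
  by (intro ball_cong refl) (auto simp: symbol_eq_iff T_intertwiner mult_op_1 mult_op_0)

theorem orthonormal_basis_transfer_module_iff:
  "orthonormal_basis (transfer_module M \<phi> S) n \<xi> \<longleftrightarrow> orthonormal \<and> op_eq M frame_operator id"
proof -
  have inner: "mod_inner (transfer_module M \<phi> S) (\<xi> i) \<eta> = op_symbol M (adj M (T i) \<circ> (mult_op \<eta> \<circ> S))"
    if "i \<in> {1..n}" "\<eta> \<in> Linf M" for i \<eta>
    unfolding transfer_inner_product[OF that, symmetric] by (simp add: transfer_module_def)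
  have sums: "(\<Sum>i\<in>{1..n}. act (transfer_module M \<phi> S) (\<xi> i) (mod_inner (transfer_module M \<phi> S) (\<xi> i) \<eta>))
    = (\<Sum>i\<in>{1..n}. \<xi> i * alpha \<phi> (op_symbol M (adj M (T i) \<circ> (mult_op \<eta> \<circ> S))))" if "\<eta> \<in> Linf M" for \<eta>
    using that by (intro sum.cong refl) (simp add: inner, simp add: transfer_module_def)
  have ortho: "orthonormal \<longleftrightarrow> (\<forall>i\<in>{1..n}. \<forall>j\<in>{1..n}.
      ae_eq M (mod_inner (transfer_module M \<phi> S) (\<xi> i) (\<xi> j)) (if i = j then 1 else 0))"
    unfolding orthonormal_iff by (intro ball_cong refl) (simp add: inner \<xi> T_def)
  have "orthonormal_basis (transfer_module M \<phi> S) n \<xi> \<longleftrightarrow> orthonormal \<and>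
      (\<forall>\<eta>\<in>Linf M. ae_eq M \<eta> (\<Sum>i\<in>{1..n}. \<xi> i * alpha \<phi> (op_symbol M (adj M (T i) \<circ> (mult_op \<eta> \<circ> S)))))"
    unfolding ortho orthonormal_basis_def using \<xi> sums
    by (simp add: transfer_module_def)
  also have "(\<forall>\<eta>\<in>Linf M. ae_eq M \<eta> (\<Sum>i\<in>{1..n}. \<xi> i * alpha \<phi> (op_symbol M (adj M (T i) \<circ> (mult_op \<eta> \<circ> S)))))
      \<longleftrightarrow> op_eq M frame_operator id"
    unfolding frame_operator_eq_id_iff_fixes_Linf[symmetric] by (intro ball_cong refl expansion_in_Linf_iff)
  finally show ?thesis .
qed

theorem orthonormal_basis_intertwiner_module_iff:
  "orthonormal_basis (intertwiner_module M \<phi>) n T \<longleftrightarrow> orthonormal \<and> op_eq M frame_operator id"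
proof -
  have exp: "op_eq M V (\<Sum>i\<in>{1..n}. T i \<circ> mult_op (op_symbol M (adj M (T i) \<circ> V))) \<longleftrightarrow> op_eq M V (frame_operator \<circ> V)"
    if "V \<in> intertwiners M \<phi>" for V
    using expansion_eq_frame_operator[OF that] by (meson op_eq_sym op_eq_trans)
  have "orthonormal_basis (intertwiner_module M \<phi>) n T \<longleftrightarrow> orthonormal \<and>
     (\<forall>V\<in>intertwiners M \<phi>. op_eq M V (\<Sum>i\<in>{1..n}. T i \<circ> mult_op (op_symbol M (adj M (T i) \<circ> V))))"
    unfolding orthonormal_basis_def orthonormal_iff using T_intertwiner
    by (simp add: intertwiner_module_def)
  also have "(\<forall>V\<in>intertwiners M \<phi>. op_eq M V (\<Sum>i\<in>{1..n}. T i \<circ> mult_op (op_symbol M (adj M (T i) \<circ> V))))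
      \<longleftrightarrow> op_eq M frame_operator id"
    unfolding frame_operator_eq_id_iff_fixes_intertwiners[symmetric] by (intro ball_cong refl exp)
  finally show ?thesis .
qed

theorem cuntz_family_iff:
  "cuntz_family M n T \<and> implements_alpha M \<phi> n T \<longleftrightarrow> orthonormal \<and> op_eq M frame_operator id"
proof -
  have "cuntz_family M n T \<longleftrightarrow> orthonormal \<and> op_eq M frame_operator id"
    using T_BL2 by (simp add: cuntz_family_def orthonormal_def frame_operator_def)
  then show ?thesis using implements_alpha_if_frame_operator_eq_id by blast
qed

end

section \<open>The polar decomposition of a composition operator\<close>

context composition
begin

lemma comp_op_intertwiner: "comp_op \<phi> \<in> intertwiners M \<phi>"
proof -
  have "comp_op \<phi> \<circ> mult_op a = mult_op (alpha \<phi> a) \<circ> comp_op \<phi>" for a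
    by (simp add: fun_eq_iff comp_op_def mult_op_def alpha_def)
  then show ?thesis using comp_BL2 by (simp add: intertwiners_iff)
qed

text \<open>
  The composition operator \<open>C\<close> is itself an intertwiner, so \<open>C\<^sup>* C\<close> is multiplication by some \<open>b\<close>, and
  \<open>\<langle>b f, f\<rangle> = \<parallel>C f\<parallel>\<^sup>2 \<ge> c\<^sup>2 \<parallel>f\<parallel>\<^sup>2\<close> gives \<open>b \<ge> c\<^sup>2\<close> almost everywhere. The positive square root of \<open>b\<close> is the
  function \<open>s\<close>, with inverse \<open>w\<close>; by uniqueness it is the symbol of the positive factor \<open>A\<close>, and \<open>C = S A\<close> can
  be solved for \<open>S\<close>.
\<close>

lemma polar_factor:
  assumes below: "bounded_below M (comp_op \<phi>)"
    and polar: "polar_decomposition M (comp_op \<phi>) S A"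
  obtains s w where "s \<in> Linf M" "w \<in> Linf M" "ae_eq M (w * s) 1"
    "op_eq M A (mult_op s)" "op_eq M S (comp_op \<phi> \<circ> mult_op w)"
proof -
  let ?C = "comp_op \<phi>"
  have A: "positive_op M A" and AA: "op_eq M (A \<circ> A) (adj M ?C \<circ> ?C)"
    and S: "S \<in> BL2 M" and CSA: "op_eq M ?C (S \<circ> A)"
    using polar by (auto simp: polar_decomposition_def partial_isometry_def)
  have AB: "A \<in> BL2 M" using A by (simp add: positive_op_def)
  obtain C' where "is_adjoint M ?C C'" by (rule adjoint_exists)
  then have adj: "is_adjoint M ?C (adj M ?C)" by (rule is_adjoint_adj)
  obtain b where b: "b \<in> Linf M" "op_eq M (adj M ?C \<circ> ?C) (mult_op b)"
    by (rule adjoint_comp_is_mult_op[OF alpha_Linf comp_op_intertwiner adj comp_op_intertwiner])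
  obtain c where c: "0 < c" "\<And>f. f \<in> L2 M \<Longrightarrow> c * L2_norm M f \<le> L2_norm M (?C f)"
    using below unfolding bounded_below_def by blast
  have low: "AE x in M. b x \<in> \<real> \<and> c\<^sup>2 \<le> Re (b x)"
  proof (rule symbol_bounded_below[OF b(1)])
    fix f assume f: "f \<in> L2 M"
    note Cf = BL2_L2[OF comp_BL2 f]
    have "L2_inner M (b * f) f = L2_inner M (adj M ?C (?C f)) f"
      using op_eqD[OF b(2) f] f Cf b(1)
      by (intro L2_inner_cong Linf_mult_L2 BL2_L2[OF is_adjoint_BL2[OF adj]])
        (auto simp: mult_op_def intro: ae_eq_sym)
    also have "\<dots> = cnj (L2_inner M (?C f) (?C f))"
      using is_adjoint_inner[OF adj f Cf] by (simp add: L2_inner_commute[of M "adj M ?C (?C f)" f])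
    also have "\<dots> = of_real ((L2_norm M (?C f))\<^sup>2)"
      by (simp add: L2_inner_self)
    finally have eq: "L2_inner M (b * f) f = of_real ((L2_norm M (?C f))\<^sup>2)" .
    have "(c * L2_norm M f)\<^sup>2 \<le> (L2_norm M (?C f))\<^sup>2"
      using c f by (intro power_mono) auto
    then show "L2_inner M (b * f) f \<in> \<real> \<and> c\<^sup>2 * (L2_norm M f)\<^sup>2 \<le> Re (L2_inner M (b * f) f)"
      unfolding eq by (auto simp: power_mult_distrib simp flip: of_real_power)
  qed
  obtain K where K: "0 \<le> K" "AE x in M. norm (b x) \<le> K" using b(1) by (rule LinfE)
  have bm [measurable]: "b \<in> borel_measurable M" using b(1) by (simp add: Linf_def)
  \<comment> \<open>Off a null set \<open>b\<close> is real and at least \<open>c\<^sup>2\<close>, so \<open>r\<close> is at least \<open>c\<close> there and \<open>w\<close> below is bounded.\<close>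
  define r where "r x = sqrt (Re (b x))" for x
  have rm [measurable]: "r \<in> borel_measurable M" unfolding r_def by measurable
  have AEr: "AE x in M. b x = of_real (r x * r x) \<and> c \<le> r x \<and> r x \<le> sqrt K"
    using low K(2)
  proof eventually_elim
    case (elim x)
    have b: "b x \<in> \<real>" "c\<^sup>2 \<le> Re (b x)" "Re (b x) \<le> K"
      using elim complex_Re_le_cmod[of "b x"] by simp_all
    have Re: "0 \<le> Re (b x)" using b(2) zero_le_power2[of c] by linarith
    then have "r x * r x = Re (b x)" by (simp add: r_def)
    then have "b x = of_real (r x * r x)" using b(1) by simp
    moreover have "c \<le> r x" unfolding r_def using b(2) by (rule real_le_rsqrt)
    moreover have "r x \<le> sqrt K" unfolding r_def using b(3) by (rule real_sqrt_le_mono)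
    ultimately show ?case by blast
  qed
  define s where "s x = complex_of_real (r x)" for x
  define w where "w x = inverse (s x)" for x
  have sm [measurable]: "s \<in> borel_measurable M" unfolding s_def by measurable
  have "AE x in M. norm (s x) \<le> sqrt K"
    using AEr by eventually_elim (use c(1) in \<open>simp add: s_def\<close>)
  then have sL: "s \<in> Linf M" using sm by (auto simp: Linf_def)
  have "AE x in M. norm (w x) \<le> inverse c"
    using AEr by eventually_elim
      (use c(1) in \<open>auto simp: s_def w_def norm_inverse intro!: le_imp_inverse_le\<close>)
  moreover have "w \<in> borel_measurable M" unfolding w_def by measurable
  ultimately have wL: "w \<in> Linf M" by (auto simp: Linf_def)
  have "AE x in M. b x = s x * s x"
    using AEr by eventually_elim (simp add: s_def)
  then have ss: "ae_eq M b (s * s)" by (simp add: ae_eq_def)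
  have ws: "ae_eq M (w * s) 1"
    unfolding ae_eq_def using AEr by eventually_elim (use c(1) in \<open>auto simp: w_def s_def\<close>)
  have As: "op_eq M A (mult_op s)"
  proof (rule positive_sqrt_unique[OF A BL2_mult_op[OF sL], where q = "sqrt K" and t = "sqrt K + c"])
    \<comment> \<open>The values of \<open>s\<close> lie in \<open>[c, \<surd>K]\<close>, so those of \<open>t - s\<close> lie in \<open>[c, \<surd>K]\<close> as well.\<close>
    show "op_eq M (A \<circ> A) (mult_op s \<circ> mult_op s)"
      using op_eq_trans[OF op_eq_trans[OF AA b(2)]] ss
      unfolding op_eq_mult_op_iff[symmetric] mult_op_mult by blast
    show "0 \<le> sqrt K" "sqrt K < sqrt K + c" using K c by auto
    fix f assume f: "f \<in> L2 M"
    let ?g = "(\<lambda>x. complex_of_real (sqrt K + c) * f x) + (\<lambda>x. -1 * mult_op s f x)"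
    show "L2_norm M ?g \<le> sqrt K * L2_norm M f"
    proof (rule L2_norm_mono(2)[OF _ f])
      show "?g \<in> borel_measurable M"
        by (intro L2D L2_add L2_scale f BL2_L2[OF BL2_mult_op[OF sL]])
      show "AE x in M. norm (?g x) \<le> sqrt K * norm (f x)"
        using AEr
      proof eventually_elim
        case (elim x)
        have "?g x = of_real (sqrt K + c - r x) * f x"
          by (simp add: mult_op_def s_def algebra_simps)
        also have "norm \<dots> = \<bar>sqrt K + c - r x\<bar> * norm (f x)"
          by (simp only: norm_mult norm_of_real)
        also have "\<dots> \<le> sqrt K * norm (f x)"
          using elim c(1) by (intro mult_right_mono) auto
        finally show ?case .
      qed
    qed (use K in simp)
  qed
  have "op_eq M S (?C \<circ> mult_op w)"
    unfolding op_eq_def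
  proof
    fix f assume f: "f \<in> L2 M"
    note wf = Linf_mult_L2[OF wL f]
    have "ae_eq M (A (w * f)) (s * (w * f))"
      using op_eqD[OF As wf] by (simp add: mult_op_def)
    also have "s * (w * f) = (w * s) * f" by (simp add: mult_ac)
    also have "ae_eq M \<dots> (1 * f)" by (intro ae_eq_mult ws ae_eq_refl)
    finally have Awf: "ae_eq M (A (w * f)) f" by (simp add: times_fun_def)
    have "ae_eq M (?C (w * f)) (S (A (w * f)))" using op_eqD[OF CSA wf] by simp
    also have "ae_eq M \<dots> (S f)" by (rule BL2_cong[OF S BL2_L2[OF AB wf] f Awf])
    finally show "ae_eq M (S f) ((?C \<circ> mult_op w) f)" by (simp add: mult_op_def ae_eq_sym)
  qed
  then show ?thesis using that sL wL ws As by blast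
qed

text \<open>
  With \<open>S = C w\<close> the three properties reduce to those of \<open>C\<close>: \<open>C w a = C a w = \<alpha>(a) C w\<close>, the adjoint
  is \<open>w\<^sup>* C\<^sup>*\<close>, and \<open>S s = C (w s) = C 1 = 1\<close>.
\<close>

lemma intertwiner_family_if_polar:
  assumes "bounded_below M (comp_op \<phi>)" and polar: "polar_decomposition M (comp_op \<phi>) S A"
    and \<xi>: "\<forall>i\<in>{1..n}. \<xi> i \<in> Linf M"
  obtains S' f0 where "intertwiner_family M \<phi> S S' f0 n \<xi>"
proof -
  let ?C = "comp_op \<phi>"
  obtain s w where sw: "s \<in> Linf M" "w \<in> Linf M" "ae_eq M (w * s) 1"
    "op_eq M A (mult_op s)" "op_eq M S (?C \<circ> mult_op w)"
    by (rule polar_factor[OF assms(1,2)])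
  have S: "S \<in> BL2 M" using polar by (simp add: polar_decomposition_def partial_isometry_def)
  have CwB: "?C \<circ> mult_op w \<in> BL2 M" by (intro BL2_comp comp_BL2 BL2_mult_op sw)
  have "?C \<circ> mult_op w \<circ> mult_op a = mult_op (alpha \<phi> a) \<circ> (?C \<circ> mult_op w)" for a
    by (simp add: fun_eq_iff comp_op_def mult_op_def alpha_def mult_ac)
  then have "?C \<circ> mult_op w \<in> intertwiners M \<phi>" using CwB by (simp add: intertwiners_iff)
  then have SI: "S \<in> intertwiners M \<phi>"
    by (rule intertwiners_cong[OF _ S sw(5) alpha_Linf])
  obtain C' where C': "is_adjoint M ?C C'" by (rule adjoint_exists)
  have SA: "is_adjoint M S (mult_op (\<lambda>x. cnj (w x)) \<circ> C')"
    by (rule is_adjoint_cong[OF op_eq_sym[OF sw(5)] CwB S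
          is_adjoint_comp[OF BL2_mult_op[OF sw(2)] C' is_adjoint_mult_op[OF sw(2)]]])
  have "ae_eq M (S s) (?C (w * s))"
    using op_eqD[OF sw(5) Linf_L2[OF sw(1)]] by (simp add: mult_op_def)
  also have "ae_eq M \<dots> (?C 1)"
    by (rule BL2_cong[OF comp_BL2 Linf_L2[OF Linf_mult[OF sw(2,1)]] one_L2 sw(3)])
  also have "?C 1 = 1" by (simp add: comp_op_def fun_eq_iff)
  finally have Ss: "ae_eq M (S s) 1" .
  have "intertwiner_family M \<phi> S (mult_op (\<lambda>x. cnj (w x)) \<circ> C') s n \<xi>"
    using SI SA Ss \<xi> Linf_L2[OF sw(1)] alpha_Linf by unfold_locales auto
  then show ?thesis using that by blast
qed

end

theorem theorem5p2:
  fixes M :: "'a::t2_space measure"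
    and \<phi> :: "'a \<Rightarrow> 'a"
    and S\<^sub>\<phi> a\<^sub>\<phi> :: "'a op"
    and n :: nat
    and \<xi> :: "nat \<Rightarrow> 'a \<Rightarrow> complex"
  assumes "compact (UNIV :: 'a set)"
    and "prob_space M" and "regular_borel_measure M"
    and "\<phi> \<in> borel \<rightarrow>\<^sub>M borel"
    and "map_bounded M \<phi>"
    and "comp_op \<phi> \<in> BL2 M" and "bounded_below M (comp_op \<phi>)"
    and "polar_decomposition M (comp_op \<phi>) S\<^sub>\<phi> a\<^sub>\<phi>"
    and "\<forall>i\<in>{1..n}. \<xi> i \<in> Linf M"
  shows
    "(orthonormal_basis (transfer_module M \<phi> S\<^sub>\<phi>) n \<xi> \<longleftrightarrow>
      orthonormal_basis (intertwiner_module M \<phi>) n (\<lambda>i. mult_op (\<xi> i) \<circ> S\<^sub>\<phi>)) \<and>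
     (orthonormal_basis (intertwiner_module M \<phi>) n (\<lambda>i. mult_op (\<xi> i) \<circ> S\<^sub>\<phi>) \<longleftrightarrow>
      cuntz_family M n (\<lambda>i. mult_op (\<xi> i) \<circ> S\<^sub>\<phi>) \<and>
      implements_alpha M \<phi> n (\<lambda>i. mult_op (\<xi> i) \<circ> S\<^sub>\<phi>))"
proof -
  interpret prob_space M by fact
  have "sets M = sets borel" using assms(3) by (simp add: regular_borel_measure_def)
  then have "\<phi> \<in> M \<rightarrow>\<^sub>M M" using assms(4) by (simp cong: measurable_cong_sets)
  then interpret composition M \<phi> using assms(6) by unfold_locales
  obtain S' f0 where "intertwiner_family M \<phi> S\<^sub>\<phi> S' f0 n \<xi>"
    by (rule intertwiner_family_if_polar[OF assms(7,8,9)])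
  then interpret F: intertwiner_family M \<phi> S\<^sub>\<phi> S' f0 n \<xi> .
  have T: "F.T = (\<lambda>i. mult_op (\<xi> i) \<circ> S\<^sub>\<phi>)" by (simp add: fun_eq_iff F.T_def)
  show ?thesis
    using F.orthonormal_basis_transfer_module_iff F.orthonormal_basis_intertwiner_module_iff
      F.cuntz_family_iff
    unfolding T by blast
qed

end
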